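(* For every $m\ge1$ let $X^{(m)}_1,\dots,X^{(m)}_m$ be independent random variables with mean zero and finite variance, and set $\sigma_m:=\sqrt{\frac1m\sum_{i=1}^m\mathrm{Var}(X^{(m)}_i)}$. Suppose $\sigma_m\ge1$ for all $m$, and that there exist constants $\delta\in[0,1)$ and $C\ge1$ such that for all $m\ge1$, $i=1,\dots,m$ and $j\ge2$, $$\mathbb{E}\big[|X^{(m)}_i|^j\big]\le j!\,(C\sigma_m)^{(1+\delta)j}.$$ Let $F_m$ be the distribution function of $(X^{(m)}_1+\dots+X^{(m)}_m)/(\sigma_m\sqrt m)$ and $\Phi$ the standard Gaussian distribution function. Assume $\sigma_m^\delta/m^{1/6}\to0$. Then for any sequence $(x_m)$ with $x_m\to\infty$ and $x_m\sigma_m^\delta/m^{1/6}\to0$, $$1-F_m(x_m)=\Big[1+O\Big(\sigma_m^{3\delta}\frac{x_m^3}{\sqrt m}\Big)\Big]\big[1-\Phi(x_m)\big]\quad\text{as }m\to\infty.$$ *)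

theory Defs
  imports "HOL-Probability.Probability" "HOL-Library.Landau_Symbols"
begin

definition Phi :: "real \<Rightarrow> real" where
  "Phi = cdf (density lborel std_normal_density)"

definition sigma_seq :: "(nat \<Rightarrow> 'a measure) \<Rightarrow> (nat \<Rightarrow> nat \<Rightarrow> 'a \<Rightarrow> real) \<Rightarrow> nat \<Rightarrow> real" where
  "sigma_seq M X m = sqrt ((1 / real m) * (\<Sum>i=1..m. prob_space.variance (M m) (X m i)))"

definition F_seq :: "(nat \<Rightarrow> 'a measure) \<Rightarrow> (nat \<Rightarrow> nat \<Rightarrow> 'a \<Rightarrow> real) \<Rightarrow> nat \<Rightarrow> real \<Rightarrow> real" where
  "F_seq M X m = cdf (distr (M m) borel
      (\<lambda>\<omega>. (\<Sum>i=1..m. X m i \<omega>) / (sigma_seq M X m * sqrt (real m))))"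

end

theory Submission
  imports Defs
begin

text \<open>
  With \<open>W\<close> the normalised sum, every summand has moments bounded by \<open>j! \<kappa>\<^sup>j\<close> for
  \<open>\<kappa> = (C \<sigma>)\<^bsup>1+\<delta>\<^esup> / (\<sigma> \<surd>m)\<close>. Hence the complex moment generating function satisfies
  \<open>E exp (z W) = exp (z\<^sup>2/2 + O(L |z|\<^sup>3))\<close> with \<open>L = m \<kappa>\<^sup>3\<close>, as long as \<open>\<kappa> |z| \<le> 1/4\<close>.
  Taking \<open>z = x + i t\<close>, this says that the law of \<open>W - x\<close> under the weight \<open>exp (x W - x\<^sup>2/2)\<close>
  has characteristic function \<open>exp (-t\<^sup>2/2 + O(L (x + |t|)\<^sup>3))\<close> for \<open>|t|\<close> up to a multiple of \<open>1/L\<close>.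
  Both tails, of \<open>W\<close> and of the Gaussian, equal \<open>exp (-x\<^sup>2/2)\<close> times the integral of the one-sided exponential
  \<open>u \<mapsto> exp (-x u)\<close>, \<open>u > 0\<close>, against the tilted law and the Gaussian law respectively. Smoothing at scale \<open>L\<close>
  with a kernel of compactly supported Fourier transform changes these integrals by \<open>O(L x)\<close>, while the smoothed
  densities differ by \<open>O(L x\<^sup>3)\<close>, hence the smoothed integrals by \<open>O(L x\<^sup>2)\<close>. As the Gaussian integral is
  at least a multiple of \<open>1/x\<close>, the relative error is \<open>O(L x\<^sup>3)\<close>. The tilt is at \<open>x\<close> itself rather
  than at the saddle point, since an error of this size is allowed anyway.
\<close>

section \<open>A smoothing kernel with compactly supported Fourier transform\<close>

lemma char_convolution:
  assumes "prob_space M" "prob_space N" and [measurable_cong]: "sets M = sets borel" "sets N = sets borel"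
  shows "char (M \<star> N) t = char M t * char N t"
proof -
  interpret M: prob_space M by fact
  interpret N: prob_space N by fact
  interpret P: pair_prob_space M N ..
  have int: "integrable (M \<Otimes>\<^sub>M N) (\<lambda>(x, y). iexp (t * (x + y)))"
    by (rule P.integrable_const_bound[where B=1]) (auto simp: norm_exp_eq_Re)
  have "char (M \<star> N) t = (CLINT p|M \<Otimes>\<^sub>M N. (\<lambda>(x, y). iexp (t * (x + y))) p)"
    unfolding char_def convolution_def by (subst integral_distr) (auto simp: case_prod_beta intro!: Bochner_Integration.integral_cong)
  also have "\<dots> = (CLINT x|M. CLINT y|N. iexp (t * (x + y)))"
    by (subst P.integral_fst'[OF int, symmetric]) simp
  also have "\<dots> = (CLINT x|M. iexp (t * x) * char N t)"
    by (simp add: char_def ring_distribs exp_add)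
  also have "\<dots> = char M t * char N t"
    by (simp add: char_def)
  finally show ?thesis .
qed

lemma prob_space_convolution:
  assumes "prob_space M" "prob_space N" and [measurable_cong]: "sets M = sets borel" "sets N = sets borel"
  shows "prob_space (M \<star> N)"
proof -
  interpret M: prob_space M by fact
  interpret N: prob_space N by fact
  interpret P: pair_prob_space M N ..
  show ?thesis unfolding convolution_def by (rule P.prob_space_distr) simp
qed

lemma AE_convolution_abs_le:
  fixes M N :: "real measure"
  assumes "prob_space M" "prob_space N" and s[measurable_cong]: "sets M = sets borel" "sets N = sets borel"
    and a: "AE x in M. \<bar>x\<bar> \<le> a" and b: "AE x in N. \<bar>x\<bar> \<le> b"
  shows "AE x in M \<star> N. \<bar>x\<bar> \<le> a + b"
proof -
  interpret M: prob_space M by fact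
  interpret N: prob_space N by fact
  interpret P: pair_sigma_finite M N ..
  have "AE x in M. AE y in N. \<bar>x + y\<bar> \<le> a + b"
    using a
  proof eventually_elim
    case (elim x)
    show ?case using b by eventually_elim (use elim in linarith)
  qed
  moreover have "{z \<in> space (M \<Otimes>\<^sub>M N). \<bar>fst z + snd z\<bar> \<le> a + b} \<in> sets (M \<Otimes>\<^sub>M N)"
    by measurable
  ultimately have "AE z in M \<Otimes>\<^sub>M N. \<bar>fst z + snd z\<bar> \<le> a + b"
    by (intro P.AE_pair_measure) auto
  then show ?thesis
    unfolding convolution_def by (subst AE_distr_iff) (auto simp: case_prod_beta)
qed

section \<open>The uniform law on [-1, 1] and its fourfold convolution\<close>

definition unif :: "real measure" where
  "unif = density lborel (\<lambda>x. ennreal (indicator {-1..1} x / 2))"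

lemma sets_unif [simp, measurable_cong]: "sets unif = sets borel"
  by (simp add: unif_def)

lemma prob_space_unif: "prob_space unif"
proof
  have "emeasure unif (space unif) = (\<integral>\<^sup>+x. ennreal (1/2) * indicator {-1..1::real} x \<partial>lborel)"
    by (auto simp: unif_def emeasure_density intro!: nn_integral_cong split: split_indicator)
  also have "\<dots> = ennreal (1/2) * ennreal 2"
    by (subst nn_integral_cmult_indicator) auto
  also have "\<dots> = 1"
    by (subst ennreal_mult[symmetric]) auto
  finally show "emeasure unif (space unif) = 1" .
qed

lemma AE_unif: "AE x in unif. \<bar>x\<bar> \<le> 1"
  unfolding unif_def by (subst AE_density) (auto intro!: AE_I2 split: split_indicator_asm)

lemma char_unif: "char unif t = of_real (sinc t)"
proof (cases "t = 0")
  \<comment> \<open>The antiderivative used in the other case divides by \<open>t\<close>. At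
    \<open>t = 0\<close> the value is the total mass 1, which is \<open>sinc 0\<close>.\<close>
  case True
  interpret prob_space unif by (rule prob_space_unif)
  show ?thesis using True prob_space by (simp add: char_def)
next
  case False
  have "char unif t = (CLBINT x. (indicator {-1..1} x / 2) *\<^sub>R iexp (t * x))"
    unfolding char_def unif_def by (subst integral_density) auto
  also have "\<dots> = (CLBINT x. indicator {-1..1} x *\<^sub>R (iexp (t * x) / 2))"
    by (intro Bochner_Integration.integral_cong) (auto split: split_indicator simp: scaleR_conv_of_real)
  also have "\<dots> = iexp (t * 1) / (2 * \<i> * t) - iexp (t * (-1)) / (2 * \<i> * t)"
  proof (rule integral_FTC_Icc[where F="\<lambda>x. iexp (t * x) / (2 * \<i> * t)"])
    show "((\<lambda>x. iexp (t * x) / (2 * \<i> * t)) has_vector_derivative iexp (t * x) / 2) (at x within {-1..1})" for x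
    proof -
      have "((\<lambda>z. exp (\<i> * (t * z)) / (2 * \<i> * t)) has_field_derivative exp (\<i> * (t * of_real x)) / 2) (at (of_real x))"
        using False by (auto intro!: derivative_eq_intros)
      from has_vector_derivative_real_field[OF this] show ?thesis
        by (auto intro: has_vector_derivative_at_within)
    qed
  qed (auto intro!: continuous_intros)
  also have "\<dots> = of_real (sinc t)"
    using False by (simp add: complex_eq_iff exp_of_real Re_divide Im_divide Re_exp Im_exp field_simps power2_eq_square)
  finally show ?thesis .
qed

text \<open>Every translate of the uniform density is at most 1/2, and averaging the translates over
  \<open>N\<close> keeps this bound. Phrasing it through integrals of \<open>h\<close> avoids
  computing the density of the convolution.\<close>

lemma nn_integral_unif_convolution_le:
  assumes N: "prob_space N" and sN[measurable_cong]: "sets N = sets borel" and [measurable]: "h \<in> borel_measurable borel"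
  shows "(\<integral>\<^sup>+x. h x \<partial>(unif \<star> N)) \<le> ennreal (1/2) * (\<integral>\<^sup>+x. h x \<partial>lborel)"
proof -
  interpret N: prob_space N by fact
  interpret U: prob_space unif by (rule prob_space_unif)
  interpret P: pair_sigma_finite N unif ..
  have "(\<integral>\<^sup>+x. h x \<partial>(unif \<star> N)) = (\<integral>\<^sup>+x. \<integral>\<^sup>+y. h (x + y) \<partial>N \<partial>unif)"
    by (rule nn_integral_convolution) (auto simp: sN U.finite_measure_axioms N.finite_measure_axioms)
  also have "\<dots> = (\<integral>\<^sup>+y. \<integral>\<^sup>+x. h (x + y) \<partial>unif \<partial>N)"
    by (rule P.Fubini') measurable
  also have "\<dots> \<le> (\<integral>\<^sup>+y. ennreal (1/2) * (\<integral>\<^sup>+x. h x \<partial>lborel) \<partial>N)"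
  proof (rule nn_integral_mono)
    fix y
    have "(\<integral>\<^sup>+x. h (x + y) \<partial>unif) = (\<integral>\<^sup>+x. ennreal (indicator {-1..1} x / 2) * h (x + y) \<partial>lborel)"
      unfolding unif_def by (subst nn_integral_density) auto
    also have "\<dots> \<le> (\<integral>\<^sup>+x. ennreal (1/2) * h (x + y) \<partial>lborel)"
      by (intro nn_integral_mono mult_right_mono ennreal_leI) (auto split: split_indicator)
    also have "\<dots> = ennreal (1/2) * (\<integral>\<^sup>+x. h (x + y) \<partial>lborel)"
      by (rule nn_integral_cmult) measurable
    also have "(\<integral>\<^sup>+x. h (x + y) \<partial>lborel) = (\<integral>\<^sup>+x. h x \<partial>lborel)"
      using nn_integral_real_affine[of h 1 y] by (simp add: add.commute)
    finally show "(\<integral>\<^sup>+x. h (x + y) \<partial>unif) \<le> ennreal (1/2) * (\<integral>\<^sup>+x. h x \<partial>lborel)" .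
  qed
  also have "\<dots> = ennreal (1/2) * (\<integral>\<^sup>+x. h x \<partial>lborel)"
    by (simp add: N.emeasure_space_1)
  finally show ?thesis .
qed

text \<open>Four uniform factors make the characteristic function nonnegative and give it a finite first absolute moment.\<close>
definition spline :: "real measure" where
  "spline = (unif \<star> (unif \<star> (unif \<star> unif)))"

lemma sets_spline [simp, measurable_cong]: "sets spline = sets borel"
  by (simp add: spline_def)

lemma prob_space_spline: "prob_space spline"
  unfolding spline_def by (intro prob_space_convolution prob_space_unif) auto

text \<open>Up to normalisation this is the Jackson kernel, the Fourier transform of a cubic
  B-spline.\<close>

definition kern :: "real \<Rightarrow> real" where
  "kern w = sinc w ^ 4"

lemma char_spline: "char spline w = of_real (kern w)"
  unfolding spline_def
  by (simp add: char_convolution prob_space_convolution prob_space_unif char_unif kern_def power4_eq_xxxx)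

text \<open>The interval comes from adding four variables bounded by 1, the factor 1/2 from a single
  uniform factor. These two facts replace the explicit piecewise cubic density.\<close>

lemma nn_integral_spline_le:
  assumes [measurable]: "h \<in> borel_measurable borel"
  shows "(\<integral>\<^sup>+s. h s \<partial>spline) \<le> ennreal (1/2) * (\<integral>\<^sup>+s. h s * indicator {-4..4} s \<partial>lborel)"
proof -
  have "AE s in spline. \<bar>s\<bar> \<le> 1 + (1 + (1 + 1))"
    unfolding spline_def by (intro AE_convolution_abs_le prob_space_convolution prob_space_unif AE_unif) auto
  then have "(\<integral>\<^sup>+s. h s \<partial>spline) = (\<integral>\<^sup>+s. h s * indicator {-4..4} s \<partial>spline)"
    by (intro nn_integral_cong_AE) (auto split: split_indicator elim!: eventually_mono)
  also have "\<dots> \<le> ennreal (1/2) * (\<integral>\<^sup>+s. h s * indicator {-4..4} s \<partial>lborel)"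
    unfolding spline_def by (intro nn_integral_unif_convolution_le prob_space_convolution prob_space_unif) auto
  finally show ?thesis .
qed

section \<open>Size and integrability of the kernel\<close>

lemma measurable_kern [measurable]: "kern \<in> borel_measurable borel"
  unfolding kern_def[abs_def] by (intro borel_measurable_power borel_measurable_sinc)

lemma kern_nonneg [simp]: "0 \<le> kern w"
  unfolding kern_def by (intro zero_le_even_power) simp

lemma abs_sinc_le_1: "\<bar>sinc w\<bar> \<le> 1"
  using abs_sin_x_le_abs_x[of w] by (auto simp: divide_simps)

lemma kern_le_1: "kern w \<le> 1"
  using power_mono[OF abs_sinc_le_1, of w 4] by (simp add: kern_def power_even_abs)

text \<open>One integrable majorant serves both \<open>kern\<close> and its first absolute moment.
  Near 0 it follows from \<open>kern_le_1\<close>; elsewhere \<open>\<bar>sin w\<bar>\<close> at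
  most 1 gives decay of order -4, of which the factor \<open>1 + \<bar>w\<bar>\<close> costs one
  order.\<close>

lemma kern_decay: "(1 + \<bar>w\<bar>) * kern w \<le> 4 * inverse (1 + w\<^sup>2)"
proof (cases "\<bar>w\<bar> \<le> 1")
  case True
  then have "w\<^sup>2 \<le> 1" by (simp add: abs_square_le_1)
  then have "2 \<le> 4 * inverse (1 + w\<^sup>2)"
    by (simp add: field_simps add_pos_nonneg)
  moreover have "(1 + \<bar>w\<bar>) * kern w \<le> 2 * 1"
    using True kern_le_1[of w] by (intro mult_mono) auto
  ultimately show ?thesis by simp
next
  case False
  define a where "a = \<bar>w\<bar>"
  have a: "a > 1" "w \<noteq> 0" using False by (auto simp: a_def)
  have "kern w = sin w ^ 4 / a ^ 4" using a by (simp add: kern_def power_divide a_def)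
  also have "\<dots> \<le> 1 / a ^ 4"
    using power_mono[of "\<bar>sin w\<bar>" 1 4] a by (intro divide_right_mono) (auto simp: power_even_abs)
  finally have "(1 + \<bar>w\<bar>) * kern w \<le> (1 + a) * (1 / a ^ 4)"
    unfolding a_def by (intro mult_left_mono) auto
  also have "\<dots> \<le> (2 * a) * (1 / a^4)"
    using a by (intro mult_right_mono) auto
  also have "\<dots> = 2 / a^3" using a by (simp add: field_simps power_numeral_reduce)
  also have "\<dots> \<le> 2 / a\<^sup>2" using a by (intro divide_left_mono) (auto simp: power_numeral_reduce)
  also have "\<dots> = 4 / (2 * w\<^sup>2)" by (simp add: a_def)
  also have "\<dots> \<le> 4 / (1 + w\<^sup>2)"
    using a one_le_power[of a 2] by (intro divide_left_mono) (auto simp: a_def add_pos_nonneg)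
  finally show ?thesis by (simp add: field_simps)
qed

text \<open>On [0, 1] the Taylor bound gives sin v at least v - v^3/6, hence at least v/2, and
  (1/2)^4 = 1/16. This lower bound lets smoothed densities control the mass of intervals.\<close>

lemma kern_ge:
  assumes "\<bar>w\<bar> \<le> 1"
  shows "1/16 \<le> kern w"
proof -
  have pos: "1/2 \<le> sinc v" if "0 \<le> v" "v \<le> 1" for v
  proof (cases "v = 0")
    case False
    have "\<bar>sin v - (\<Sum>m<3. sin_coeff m * v ^ m)\<bar> \<le> inverse (fact 3) * \<bar>v\<bar> ^ 3"
      by (rule Maclaurin_sin_bound)
    then have "\<bar>sin v - v\<bar> \<le> v ^ 3 / 6"
      using that by (simp add: sin_coeff_def numeral_eq_Suc)
    moreover have "v ^ 3 \<le> v ^ 1" using that by (intro power_decreasing) auto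
    ultimately have "v / 2 \<le> sin v" unfolding power_one_right using that by arith
    then show ?thesis using that False by (simp add: field_simps)
  qed simp
  have "1/2 \<le> sinc w"
    using pos[of w] pos[of "-w"] assms by (cases "0 \<le> w") auto
  then have "(1/2)^4 \<le> kern w"
    unfolding kern_def by (intro power_mono) auto
  then show ?thesis by (simp add: power_numeral_reduce)
qed

definition kern_mass :: real where
  "kern_mass = (LBINT w. kern w)"

definition kern_moment :: real where
  "kern_moment = (LBINT w. \<bar>w\<bar> * kern w)"

lemma integrable_kern: "integrable lborel kern"
  and integrable_abs_kern: "integrable lborel (\<lambda>w. \<bar>w\<bar> * kern w)"
proof -
  have "integrable lborel (\<lambda>x::real. 4 * inverse (1 + x\<^sup>2))"
    using integrable_inverse_1_plus_square by (simp add: set_integrable_def)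
  note * = Bochner_Integration.integrable_bound[OF this]
  have "kern w \<le> 4 * inverse (1 + w\<^sup>2)" "\<bar>w\<bar> * kern w \<le> 4 * inverse (1 + w\<^sup>2)" for w
    using kern_decay[of w] mult_nonneg_nonneg[of "\<bar>w\<bar>" "kern w"] kern_nonneg[of w]
    unfolding ring_distribs by linarith+
  then show "integrable lborel kern" "integrable lborel (\<lambda>w. \<bar>w\<bar> * kern w)"
    by (auto intro!: * AE_I2 simp: abs_mult)
qed

lemma nn_integral_kern: "(\<integral>\<^sup>+w. ennreal (kern w) \<partial>lborel) = ennreal kern_mass"
  unfolding kern_mass_def by (intro nn_integral_eq_integral integrable_kern) auto

lemma kern_moment_nonneg: "0 \<le> kern_moment"
  unfolding kern_moment_def by (intro integral_nonneg_AE) auto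

lemma kern_mass_pos: "0 < kern_mass"
proof -
  have "ennreal (1/8) = ennreal (1/16) * ennreal 2"
    by (subst ennreal_mult[symmetric]) auto
  also have "\<dots> = (\<integral>\<^sup>+w. ennreal (1/16) * indicator {-1..1::real} w \<partial>lborel)"
    by (subst nn_integral_cmult_indicator) auto
  also have "\<dots> \<le> (\<integral>\<^sup>+w. ennreal (kern w) \<partial>lborel)"
    by (intro nn_integral_mono) (use kern_ge in \<open>auto intro!: ennreal_leI split: split_indicator\<close>)
  finally show ?thesis
    by (auto simp: nn_integral_kern ennreal_le_iff2)
qed

text \<open>Up to the factor \<open>kern_mass\<close>, the density of \<open>\<nu>\<close> convolved with the rescaled kernel.\<close>
definition smoothed :: "real measure \<Rightarrow> real \<Rightarrow> real \<Rightarrow> ennreal" where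
  "smoothed \<nu> T v = (\<integral>\<^sup>+u. ennreal (T * kern (T * (u - v))) \<partial>\<nu>)"

text \<open>Fubini for \<open>iexp (T * (u - v) * s)\<close>. With \<open>S = spline\<close> the
  left integrand becomes the kernel, while the right side sees \<open>char \<nu>\<close> only at
  \<open>T * s\<close> with \<open>s\<close> in [-4, 4].\<close>

lemma integral_char_Parseval:
  assumes "finite_measure \<nu>" "finite_measure S"
    and [measurable_cong]: "sets \<nu> = sets borel" "sets S = sets borel"
  shows "(CLINT u|\<nu>. char S (T * (u - v))) = (CLINT s|S. iexp (- (T * s * v)) * char \<nu> (T * s))"
proof -
  interpret V: finite_measure \<nu> by fact
  interpret S: finite_measure S by fact
  interpret P: pair_sigma_finite S \<nu> ..
  interpret P2: finite_measure "S \<Otimes>\<^sub>M \<nu>" by (rule finite_measure_pair_measure) fact+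
  have "integrable (S \<Otimes>\<^sub>M \<nu>) (\<lambda>(s, u). iexp (T * (u - v) * s))"
    by (rule P2.integrable_const_bound[where B=1]) (auto simp: norm_exp_eq_Re)
  from P.Fubini_integral[OF this]
  have "(CLINT u|\<nu>. char S (T * (u - v))) = (CLINT s|S. CLINT u|\<nu>. iexp (T * (u - v) * s))"
    by (simp add: char_def)
  also have "\<dots> = (CLINT s|S. CLINT u|\<nu>. iexp (- (T * s * v)) * iexp (T * s * u))"
    by (simp add: exp_add[symmetric] ring_distribs mult_ac)
  finally show ?thesis by (simp add: char_def)
qed

lemma measurable_char:
  assumes "finite_measure \<nu>" and [measurable_cong]: "sets \<nu> = sets borel"
  shows "char \<nu> \<in> borel_measurable borel"
proof -
  interpret finite_measure \<nu> by fact
  show ?thesis unfolding char_def[abs_def] by measurable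
qed

lemma smoothed_eq:
  assumes "finite_measure \<nu>" and [measurable_cong]: "sets \<nu> = sets borel" and T: "0 < T"
  shows "smoothed \<nu> T v = ennreal (T * (LINT u|\<nu>. kern (T * (u - v))))"
proof -
  interpret finite_measure \<nu> by fact
  have "integrable \<nu> (\<lambda>u. kern (T * (u - v)))"
    by (rule integrable_const_bound[where B=1]) (auto simp: kern_le_1)
  then show ?thesis
    unfolding smoothed_def using T by (subst nn_integral_eq_integral) auto
qed

text \<open>By Parseval the two smoothed values differ by a \<open>spline\<close> average of the
  difference of characteristic functions. The phase containing \<open>v\<close> has modulus 1, so
  the bound is uniform in \<open>v\<close>; the 1/2 is the density bound for \<open>spline\<close>.
  The one-sided additive form avoids subtraction in \<open>ennreal\<close>.\<close>

lemma smoothed_le_add: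
  assumes fin: "finite_measure \<nu>" "finite_measure \<mu>"
    and s[measurable_cong]: "sets \<nu> = sets borel" "sets \<mu> = sets borel"
    and T: "0 < T" and D0: "0 \<le> D"
    and D: "(\<integral>\<^sup>+t. ennreal (cmod (char \<nu> t - char \<mu> t)) * indicator {-4*T..4*T} t \<partial>lborel) \<le> ennreal D"
  shows "smoothed \<nu> T v \<le> smoothed \<mu> T v + ennreal (D / 2)"
proof -
  define h where "h t = cmod (char \<nu> t - char \<mu> t)" for t
  note [measurable] = measurable_char[OF fin(1) s(1)] measurable_char[OF fin(2) s(2)]
  have [measurable]: "h \<in> borel_measurable borel" unfolding h_def[abs_def] by measurable
  interpret S: prob_space spline by (rule prob_space_spline)
  interpret V: finite_measure \<nu> by fact
  interpret U: finite_measure \<mu> by fact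
  have bd: "cmod (char \<nu> t) \<le> measure \<nu> (space \<nu>)" "cmod (char \<mu> t) \<le> measure \<mu> (space \<mu>)" for t
    unfolding char_def by (rule order.trans[OF integral_norm_bound], simp add: norm_exp_eq_Re)+
  have int: "integrable spline (\<lambda>s. iexp (- (T * s * v)) * char \<nu> (T * s))"
     "integrable spline (\<lambda>s. iexp (- (T * s * v)) * char \<mu> (T * s))"
    by (rule S.integrable_const_bound[OF AE_I2], simp add: norm_mult norm_exp_eq_Re, rule bd, measurable)+
  have hbd: "h t \<le> measure \<nu> (space \<nu>) + measure \<mu> (space \<mu>)" for t
    unfolding h_def using norm_triangle_ineq4[of "char \<nu> t" "char \<mu> t"] bd[of t] by linarith
  have hint: "integrable spline (\<lambda>s. h (T * s))"
    by (rule S.integrable_const_bound, rule AE_I2) (use hbd in \<open>auto simp: h_def\<close>)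
  have ind: "- (4 * T) \<le> T * s \<and> T * s \<le> 4 * T \<longleftrightarrow> - 4 \<le> s \<and> s \<le> 4" for s
    using mult_le_cancel_left_pos[OF T, of "-4" s] mult_le_cancel_left_pos[OF T, of s 4] by (simp add: mult.commute)
  let ?I = "\<lambda>\<rho>. LINT u|\<rho>. kern (T * (u - v))"
  have eq: "complex_of_real (?I \<rho>) = (CLINT s|spline. iexp (- (T * s * v)) * char \<rho> (T * s))"
    if "finite_measure \<rho>" "sets \<rho> = sets borel" for \<rho>
    using integral_char_Parseval[OF that(1) S.finite_measure_axioms that(2) sets_spline, of T v]
    by (simp add: char_spline)
  have "?I \<nu> - ?I \<mu> \<le> cmod (of_real (?I \<nu>) - of_real (?I \<mu>))"
    by (metis abs_ge_self norm_of_real of_real_diff)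
  also have "\<dots> = cmod (CLINT s|spline. iexp (- (T * s * v)) * char \<nu> (T * s) - iexp (- (T * s * v)) * char \<mu> (T * s))"
    using fin s int by (simp add: eq)
  also have "\<dots> \<le> (LINT s|spline. cmod (iexp (- (T * s * v)) * char \<nu> (T * s) - iexp (- (T * s * v)) * char \<mu> (T * s)))"
    by (rule integral_norm_bound)
  also have "\<dots> = (LINT s|spline. h (T * s))"
    by (simp add: h_def norm_mult norm_exp_eq_Re flip: right_diff_distrib)
  finally have 1: "?I \<nu> - ?I \<mu> \<le> (LINT s|spline. h (T * s))" .
  have "ennreal (LINT s|spline. h (T * s)) = (\<integral>\<^sup>+s. ennreal (h (T * s)) \<partial>spline)"
    by (rule nn_integral_eq_integral[symmetric, OF hint]) (auto simp: h_def)
  also have "\<dots> \<le> ennreal (1/2) * (\<integral>\<^sup>+s. ennreal (h (T * s)) * indicator {-4..4} s \<partial>lborel)"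
    by (rule nn_integral_spline_le) measurable
  finally have "ennreal T * ennreal (LINT s|spline. h (T * s)) \<le> ennreal T * (ennreal (1/2) * (\<integral>\<^sup>+s. ennreal (h (T * s)) * indicator {-4..4} s \<partial>lborel))"
    by (rule mult_left_mono) auto
  also have "\<dots> = ennreal (1/2) * (ennreal T * (\<integral>\<^sup>+s. ennreal (h (T * s)) * indicator {-4..4} s \<partial>lborel))"
    by (simp add: mult_ac)
  \<comment> \<open>The substitution \<open>t = T * s\<close> absorbs the factor \<open>T\<close>
    and turns [-4, 4] into the interval in the hypothesis on \<open>D\<close>. The summand 0 only
    brings the integrand into affine form.\<close>
  also have "ennreal T * (\<integral>\<^sup>+s. ennreal (h (T * s)) * indicator {-4..4} s \<partial>lborel)
      = ennreal T * (\<integral>\<^sup>+s. ennreal (h (0 + T * s)) * indicator {-4*T..4*T} (0 + T * s) \<partial>lborel)"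
    by (simp add: indicator_def ind)
  also have "\<dots> = (\<integral>\<^sup>+t. ennreal (h t) * indicator {-4*T..4*T} t \<partial>lborel)"
    using T by (subst nn_integral_real_affine[of _ T 0]) auto
  also have "ennreal (1/2) * \<dots> \<le> ennreal (1/2) * ennreal D"
    using D by (intro mult_left_mono) (auto simp: h_def)
  also have "\<dots> = ennreal (D / 2)"
    using D0 by (subst ennreal_mult[symmetric]) auto
  finally have "ennreal (T * (LINT s|spline. h (T * s))) \<le> ennreal (D / 2)"
    using T by (subst ennreal_mult) (auto simp: h_def)
  then have 2: "T * (LINT s|spline. h (T * s)) \<le> D / 2"
    using D0 by (subst (asm) ennreal_le_iff) auto
  have "T * ?I \<nu> \<le> T * ?I \<mu> + D / 2"
    using mult_left_mono[OF 1, of T] 2 T by (simp add: ring_distribs)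
  then have "ennreal (T * ?I \<nu>) \<le> ennreal (T * ?I \<mu> + D / 2)"
    by (rule ennreal_leI)
  also have "\<dots> = ennreal (T * ?I \<mu>) + ennreal (D / 2)"
    using T D0 by (intro ennreal_plus) auto
  finally show ?thesis
    using fin s T by (simp add: smoothed_eq)
qed

section \<open>Smoothing one-sided exponentials\<close>

text \<open>The half-line is open because the tails are those of the strict event
  \<open>x < W\<close>, the complement of what a distribution function measures.\<close>

definition lap :: "real \<Rightarrow> real \<Rightarrow> real" where
  "lap x u = exp (- (x * u)) * indicator {0<..} u"

lemma measurable_lap [measurable]: "lap x \<in> borel_measurable borel"
  unfolding lap_def[abs_def] by measurable

lemma lap_nonneg [simp]: "0 \<le> lap x u"
  by (simp add: lap_def)

lemma lap_le_1: "0 \<le> x \<Longrightarrow> lap x u \<le> 1"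
  by (auto simp: lap_def split: split_indicator)

lemma nn_integral_lap:
  assumes "0 < x"
  shows "(\<integral>\<^sup>+u. ennreal (lap x u) \<partial>lborel) = ennreal (1 / x)"
proof -
  interpret prob_space "density lborel (exponential_density x)"
    by (rule prob_space_exponential_density) fact
  have "(\<integral>\<^sup>+u. ennreal (lap x u) \<partial>lborel) = (\<integral>\<^sup>+u. ennreal (1 / x) * ennreal (exponential_density x u) \<partial>lborel)"
  proof (rule nn_integral_cong_AE)
    \<comment> \<open>At 0 the exponential density equals \<open>x\<close> whereas
      \<open>lap x\<close> vanishes, so the two sides agree only almost everywhere.\<close>
    have "AE u in lborel. u \<noteq> (0::real)" by (rule AE_lborel_singleton)
    then show "AE u in lborel. ennreal (lap x u) = ennreal (1 / x) * ennreal (exponential_density x u)"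
      by eventually_elim (use assms in \<open>auto simp: lap_def exponential_density_def mult.commute
        simp flip: ennreal_mult split: split_indicator\<close>)
  qed
  also have "\<dots> = ennreal (1 / x)"
    using emeasure_space_1 by (simp add: nn_integral_cmult emeasure_density)
  finally show ?thesis .
qed

text \<open>On one side of 0 the function is Lipschitz with constant \<open>x\<close>. If 0
  separates the points, the difference is at most 1 and \<open>\<bar>u\<bar>\<close> is at most
  \<open>\<bar>u - w\<bar>\<close>. The indicator is kept in \<open>u\<close> so that, for a fixed
  displacement, integrating it gives the mass of an interval around 0.\<close>

lemma lap_diff_le:
  assumes "0 \<le> x"
  shows "\<bar>lap x u - lap x w\<bar> \<le> x * \<bar>u - w\<bar> + indicator {-\<bar>u - w\<bar>..\<bar>u - w\<bar>} u"
proof -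
  have *: "exp (- (x * a)) \<le> exp (- (x * b)) + x * \<bar>a - b\<bar>" if "0 < a" "0 < b" for a b
  proof (cases "a \<le> b")
    case True
    have "1 - x * (b - a) \<le> exp (- (x * (b - a)))"
      using exp_ge_add_one_self[of "- (x * (b - a))"] by simp
    then have "exp (- (x * a)) * (1 - x * (b - a)) \<le> exp (- (x * a)) * exp (- (x * (b - a)))"
      by (rule mult_left_mono) simp
    also have "\<dots> = exp (- (x * b))" by (simp add: algebra_simps flip: exp_add)
    finally have "exp (- (x * a)) \<le> exp (- (x * b)) + exp (- (x * a)) * (x * (b - a))"
      by (simp add: algebra_simps)
    moreover have "exp (- (x * a)) * (x * (b - a)) \<le> 1 * (x * (b - a))"
      using that assms True by (intro mult_right_mono) auto
    ultimately show ?thesis using True by simp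
  next
    case False
    then have "exp (- (x * a)) \<le> exp (- (x * b))"
      using assms by (auto intro: mult_left_mono)
    then show ?thesis using assms by (simp add: add_increasing2)
  qed
  have nn: "0 \<le> x * \<bar>u - w\<bar>" using assms by simp
  consider "0 < u" "0 < w" | "u \<le> 0" "w \<le> 0" | "u \<le> 0" "0 < w" | "0 < u" "w \<le> 0" by linarith
  then show ?thesis
  proof cases
    case 1
    then have "\<bar>lap x u - lap x w\<bar> \<le> x * \<bar>u - w\<bar>"
      using *[of u w] *[of w u] by (auto simp: lap_def abs_le_iff abs_minus_commute)
    then show ?thesis by (simp add: add_increasing2)
  next
    case 2
    then show ?thesis using nn by (simp add: lap_def)
  next
    case 3
    then have "indicator {-\<bar>u - w\<bar>..\<bar>u - w\<bar>} u = (1::real)" by (auto split: split_indicator)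
    with lap_le_1[OF assms, of u] lap_le_1[OF assms, of w] nn lap_nonneg[of x u] lap_nonneg[of x w]
    show ?thesis by linarith
  next
    case 4
    then have "indicator {-\<bar>u - w\<bar>..\<bar>u - w\<bar>} u = (1::real)" by (auto split: split_indicator)
    with lap_le_1[OF assms, of u] lap_le_1[OF assms, of w] nn lap_nonneg[of x u] lap_nonneg[of x w]
    show ?thesis by linarith
  qed
qed

text \<open>For \<open>u\<close> in the interval, all \<open>v\<close> within 1/T of
  \<open>u\<close> lie in the enlarged interval \<open>J\<close>, and there the rescaled kernel is
  at least T/16, which integrates to at least (T/16)(2/T) = 1/8. Exchanging the integrals bounds the
  mass by 8 \<open>B\<close> times the length of \<open>J\<close>.\<close>

lemma emeasure_interval_le_smoothed:
  assumes "finite_measure \<nu>" and s[measurable_cong]: "sets \<nu> = sets borel" and T: "0 < T" and r: "0 \<le> r"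
    and B: "0 \<le> B" "\<And>v. smoothed \<nu> T v \<le> ennreal B"
  shows "emeasure \<nu> {-r..r} \<le> ennreal (16 * B * (r + 1 / T))"
proof -
  interpret V: finite_measure \<nu> by fact
  interpret P: pair_sigma_finite lborel \<nu> ..
  define J where "J = {-r - 1/T..r + 1/T}"
  have [measurable]: "J \<in> sets borel" by (simp add: J_def)
  have inner: "ennreal (1/8) * indicator {-r..r} u \<le> (\<integral>\<^sup>+v. indicator J v * ennreal (T * kern (T * (u - v))) \<partial>lborel)" for u
  proof (cases "u \<in> {-r..r}")
    case True
    have "ennreal (1/8) = ennreal (T/16) * ennreal (2/T)"
      using T by (subst ennreal_mult[symmetric]) auto
    also have "\<dots> = (\<integral>\<^sup>+v. ennreal (T/16) * indicator {u - 1/T..u + 1/T} v \<partial>lborel)"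
      using T by (subst nn_integral_cmult_indicator) auto
    also have "\<dots> \<le> (\<integral>\<^sup>+v. indicator J v * ennreal (T * kern (T * (u - v))) \<partial>lborel)"
    proof (rule nn_integral_mono)
      fix v
      show "ennreal (T/16) * indicator {u - 1/T..u + 1/T} v \<le> indicator J v * ennreal (T * kern (T * (u - v)))"
      proof (cases "v \<in> {u - 1/T..u + 1/T}")
        case v: True
        then have "v \<in> J" using True by (auto simp: J_def)
        have "\<bar>u - v\<bar> \<le> 1/T" using v by (auto simp: abs_le_iff)
        then have "\<bar>T * (u - v)\<bar> \<le> 1"
          using mult_left_mono[of "\<bar>u - v\<bar>" "1/T" T] T by (simp add: abs_mult)
        from kern_ge[OF this] have "T / 16 \<le> T * kern (T * (u - v))"
          using T by (simp add: field_simps)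
        then show ?thesis using v \<open>v \<in> J\<close> by (simp add: ennreal_leI)
      qed simp
    qed
    finally show ?thesis using True by simp
  qed simp
  have "ennreal (1/8) * emeasure \<nu> {-r..r} = (\<integral>\<^sup>+u. ennreal (1/8) * indicator {-r..r} u \<partial>\<nu>)"
    by (subst nn_integral_cmult_indicator) auto
  also have "\<dots> \<le> (\<integral>\<^sup>+u. \<integral>\<^sup>+v. indicator J v * ennreal (T * kern (T * (u - v))) \<partial>lborel \<partial>\<nu>)"
    by (intro nn_integral_mono inner)
  also have "\<dots> = (\<integral>\<^sup>+v. \<integral>\<^sup>+u. indicator J v * ennreal (T * kern (T * (u - v))) \<partial>\<nu> \<partial>lborel)"
    by (rule P.Fubini') measurable
  also have "\<dots> = (\<integral>\<^sup>+v. indicator J v * smoothed \<nu> T v \<partial>lborel)"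
    unfolding smoothed_def by (simp add: nn_integral_cmult)
  also have "\<dots> \<le> (\<integral>\<^sup>+v. ennreal B * indicator J v \<partial>lborel)"
    using B by (intro nn_integral_mono) (auto split: split_indicator)
  also have "\<dots> = ennreal B * ennreal (2 * r + 2/T)"
    using T r by (subst nn_integral_cmult_indicator) (auto simp: J_def)
  also have "\<dots> = ennreal (B * (2 * r + 2/T))"
    using T r B by (subst ennreal_mult) auto
  finally have "ennreal 8 * (ennreal (1/8) * emeasure \<nu> {-r..r}) \<le> ennreal 8 * ennreal (B * (2 * r + 2/T))"
    by (rule mult_left_mono) simp
  also have "ennreal 8 * (ennreal (1/8) * emeasure \<nu> {-r..r}) = (ennreal 8 * ennreal (1/8)) * emeasure \<nu> {-r..r}"
    by (simp add: mult.assoc)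
  also have "ennreal 8 * ennreal (1/8) = 1"
    by (subst ennreal_mult[symmetric]) auto
  also have "ennreal 8 * ennreal (B * (2 * r + 2/T)) = ennreal (8 * (B * (2 * r + 2/T)))"
    using T r B by (subst ennreal_mult[symmetric]) auto
  also have "8 * (B * (2 * r + 2/T)) = 16 * B * (r + 1 / T)" by (simp add: algebra_simps)
  finally show ?thesis by simp
qed

text \<open>Fubini and the substitution \<open>v = u - y / T\<close>. The left side can be compared
  between measures through their smoothed densities; the right side is a perturbation of
  \<open>kern_mass\<close> times the integral of \<open>lap x\<close>.\<close>

lemma nn_integral_lap_smoothed:
  assumes "finite_measure \<nu>" and s[measurable_cong]: "sets \<nu> = sets borel" and T: "0 < T"
  shows "(\<integral>\<^sup>+v. ennreal (lap x v) * smoothed \<nu> T v \<partial>lborel)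
    = (\<integral>\<^sup>+u. \<integral>\<^sup>+y. ennreal (lap x (u - y / T)) * ennreal (kern y) \<partial>lborel \<partial>\<nu>)"
proof -
  interpret V: finite_measure \<nu> by fact
  interpret P: pair_sigma_finite lborel \<nu> ..
  have "(\<integral>\<^sup>+v. ennreal (lap x v) * smoothed \<nu> T v \<partial>lborel)
     = (\<integral>\<^sup>+v. \<integral>\<^sup>+u. ennreal (lap x v) * ennreal (T * kern (T * (u - v))) \<partial>\<nu> \<partial>lborel)"
    unfolding smoothed_def by (simp add: nn_integral_cmult)
  also have "\<dots> = (\<integral>\<^sup>+u. \<integral>\<^sup>+v. ennreal (lap x v) * ennreal (T * kern (T * (u - v))) \<partial>lborel \<partial>\<nu>)"
    by (rule P.Fubini'[symmetric]) measurable
  also have "\<dots> = (\<integral>\<^sup>+u. \<integral>\<^sup>+y. ennreal (lap x (u - y / T)) * ennreal (kern y) \<partial>lborel \<partial>\<nu>)"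
  proof (rule nn_integral_cong)
    fix u
    have "(\<integral>\<^sup>+v. ennreal (lap x v) * ennreal (T * kern (T * (u - v))) \<partial>lborel)
       = ennreal \<bar>- 1 / T\<bar> * (\<integral>\<^sup>+y. ennreal (lap x (u + (- 1 / T) * y)) * ennreal (T * kern (T * (u - (u + (- 1 / T) * y)))) \<partial>lborel)"
      using T by (intro nn_integral_real_affine) auto
    also have "\<dots> = (\<integral>\<^sup>+y. ennreal \<bar>- 1 / T\<bar> * (ennreal (lap x (u + (- 1 / T) * y)) * ennreal (T * kern (T * (u - (u + (- 1 / T) * y))))) \<partial>lborel)"
      by (rule nn_integral_cmult[symmetric]) measurable
    also have "\<dots> = (\<integral>\<^sup>+y. ennreal (lap x (u - y / T)) * ennreal (kern y) \<partial>lborel)"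
      using T by (intro nn_integral_cong) (simp flip: ennreal_mult)
    finally show "(\<integral>\<^sup>+v. ennreal (lap x v) * ennreal (T * kern (T * (u - v))) \<partial>lborel) = \<dots>" .
  qed
  finally show ?thesis .
qed

text \<open>Bounds the change of \<open>lap x\<close> between \<open>u\<close> and \<open>u - y / T\<close>: a Lipschitz term and the jump at \<open>0\<close>.\<close>
definition blur :: "real \<Rightarrow> real \<Rightarrow> real \<Rightarrow> real \<Rightarrow> real" where
  "blur x T u y = x * \<bar>y\<bar> / T + indicator {-(\<bar>y\<bar>/T)..\<bar>y\<bar>/T} u"

text \<open>The interval in \<open>blur\<close> has endpoints depending on \<open>y\<close>, so
  joint measurability is obtained by expanding the indicator into inequalities.\<close>

lemma measurable_blur [measurable (raw)]:
  assumes [measurable]: "f \<in> borel_measurable M" "g \<in> borel_measurable M"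
  shows "(\<lambda>z. blur x T (f z) (g z)) \<in> borel_measurable M"
  unfolding blur_def indicator_def atLeastAtMost_iff by measurable

lemma blur_nonneg: "0 \<le> x \<Longrightarrow> 0 < T \<Longrightarrow> 0 \<le> blur x T u y"
  by (simp add: blur_def)

text \<open>Integrating in \<open>u\<close> first, the Lipschitz term produces the total mass and
  the jump term the mass of an interval of radius \<open>\<bar>y\<bar> / T\<close>, controlled by
  \<open>emeasure_interval_le_smoothed\<close>. Integrating in \<open>y\<close> then leaves only
  \<open>kern_moment\<close> and \<open>kern_mass\<close>.\<close>

lemma smoothing_error_le:
  assumes "finite_measure \<nu>" and s[measurable_cong]: "sets \<nu> = sets borel" and T: "0 < T" and x: "0 \<le> x"
    and B: "0 \<le> B" "\<And>v. smoothed \<nu> T v \<le> ennreal B"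
  shows "(\<integral>\<^sup>+u. \<integral>\<^sup>+y. ennreal (blur x T u y) * ennreal (kern y) \<partial>lborel \<partial>\<nu>)
    \<le> ennreal ((x * kern_moment * measure \<nu> (space \<nu>) + 16 * B * (kern_moment + kern_mass)) / T)"
proof -
  interpret V: finite_measure \<nu> by fact
  interpret P: pair_sigma_finite lborel \<nu> ..
  have "(\<integral>\<^sup>+u. \<integral>\<^sup>+y. ennreal (blur x T u y) * ennreal (kern y) \<partial>lborel \<partial>\<nu>)
    = (\<integral>\<^sup>+y. \<integral>\<^sup>+u. ennreal (blur x T u y) * ennreal (kern y) \<partial>\<nu> \<partial>lborel)"
    by (rule P.Fubini') measurable
  also have "\<dots> \<le> (\<integral>\<^sup>+y. ennreal ((x * \<bar>y\<bar> / T) * measure \<nu> (space \<nu>) + 16 * B * (\<bar>y\<bar> / T + 1 / T)) * ennreal (kern y) \<partial>lborel)"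
  proof (rule nn_integral_mono)
    fix y
    have "(\<integral>\<^sup>+u. ennreal (blur x T u y) * ennreal (kern y) \<partial>\<nu>)
      = (\<integral>\<^sup>+u. ennreal (x * \<bar>y\<bar> / T) + indicator {-(\<bar>y\<bar>/T)..\<bar>y\<bar>/T} u \<partial>\<nu>) * ennreal (kern y)"
      using x T by (subst nn_integral_multc[symmetric]) (auto simp: blur_def ennreal_plus ennreal_indicator intro!: nn_integral_cong)
    also have "(\<integral>\<^sup>+u. ennreal (x * \<bar>y\<bar> / T) + indicator {-(\<bar>y\<bar>/T)..\<bar>y\<bar>/T} u \<partial>\<nu>)
      = ennreal (x * \<bar>y\<bar> / T) * emeasure \<nu> (space \<nu>) + emeasure \<nu> {-(\<bar>y\<bar>/T)..\<bar>y\<bar>/T}"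
      by (subst nn_integral_add) auto
    also have "\<dots> \<le> ennreal (x * \<bar>y\<bar> / T) * ennreal (measure \<nu> (space \<nu>)) + ennreal (16 * B * (\<bar>y\<bar> / T + 1 / T))"
      using emeasure_interval_le_smoothed[OF assms(1) s T _ B, of "\<bar>y\<bar> / T"] T
      by (intro add_mono) (auto simp: V.emeasure_eq_measure)
    also have "\<dots> = ennreal ((x * \<bar>y\<bar> / T) * measure \<nu> (space \<nu>) + 16 * B * (\<bar>y\<bar> / T + 1 / T))"
      using x T B by (subst ennreal_plus) (auto simp del: times_divide_eq_left times_divide_eq_right simp flip: ennreal_mult)
    finally show "(\<integral>\<^sup>+u. ennreal (blur x T u y) * ennreal (kern y) \<partial>\<nu>)
      \<le> ennreal ((x * \<bar>y\<bar> / T) * measure \<nu> (space \<nu>) + 16 * B * (\<bar>y\<bar> / T + 1 / T)) * ennreal (kern y)"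
      by (simp add: mult_right_mono)
  qed
  also have "\<dots> = (\<integral>\<^sup>+y. ennreal ((x * measure \<nu> (space \<nu>) + 16 * B) / T * (\<bar>y\<bar> * kern y) + 16 * B / T * kern y) \<partial>lborel)"
    using x T B by (intro nn_integral_cong) (simp add: field_simps flip: ennreal_mult)
  also have "\<dots> = ennreal (LBINT y. (x * measure \<nu> (space \<nu>) + 16 * B) / T * (\<bar>y\<bar> * kern y) + 16 * B / T * kern y)"
    using x T B integrable_kern integrable_abs_kern by (intro nn_integral_eq_integral AE_I2) auto
  also have "(LBINT y. (x * measure \<nu> (space \<nu>) + 16 * B) / T * (\<bar>y\<bar> * kern y) + 16 * B / T * kern y)
     = (x * measure \<nu> (space \<nu>) + 16 * B) / T * kern_moment + 16 * B / T * kern_mass"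
    using integrable_kern integrable_abs_kern by (simp add: kern_mass_def kern_moment_def)
  also have "\<dots> = (x * kern_moment * measure \<nu> (space \<nu>) + 16 * B * (kern_moment + kern_mass)) / T"
    using T by (simp add: field_simps)
  finally show ?thesis .
qed

text \<open>The measure is changed only after smoothing: unsmoothed to smoothed for \<nu>, from
  \<nu> to \<mu>, and back for \<mu>. The outer moves cost one smoothing error each, the middle one
  \<open>D / 2\<close> times the integral 1/x of \<open>lap x\<close>. Exchanging the measures gives
  the reverse estimate.\<close>

lemma smoothing_inequality:
  assumes fin: "finite_measure \<nu>" "finite_measure \<mu>"
    and s: "sets \<nu> = sets borel" "sets \<mu> = sets borel"
    and T: "0 < T" and x: "0 < x" and D0: "0 \<le> D"
    and D: "(\<integral>\<^sup>+t. ennreal (cmod (char \<nu> t - char \<mu> t)) * indicator {-4*T..4*T} t \<partial>lborel) \<le> ennreal D"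
    and B: "0 \<le> B" "\<And>v. smoothed \<nu> T v \<le> ennreal B" "\<And>v. smoothed \<mu> T v \<le> ennreal B"
    and m: "measure \<nu> (space \<nu>) \<le> m" "measure \<mu> (space \<mu>) \<le> m"
  shows "kern_mass * (LINT u|\<nu>. lap x u) \<le> kern_mass * (LINT u|\<mu>. lap x u)
     + D / (2 * x) + 2 * (x * kern_moment * m + 16 * B * (kern_moment + kern_mass)) / T"
proof -
  let ?f = "\<lambda>u. ennreal (lap x u)"
  let ?N = "\<lambda>\<rho>. \<integral>\<^sup>+u. ?f u \<partial>\<rho>"
  let ?G = "\<lambda>\<rho>. \<integral>\<^sup>+u. \<integral>\<^sup>+y. ennreal (lap x (u - y / T)) * ennreal (kern y) \<partial>lborel \<partial>\<rho>"
  let ?e = "\<lambda>u y. ennreal (blur x T u y) * ennreal (kern y)"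
  let ?E = "(x * kern_moment * m + 16 * B * (kern_moment + kern_mass)) / T"
  have m0: "0 \<le> m" using m measure_nonneg order.trans by blast
  have E0: "0 \<le> ?E"
    using T x B m0 kern_moment_nonneg kern_mass_pos by (intro divide_nonneg_pos add_nonneg_nonneg mult_nonneg_nonneg) auto
  have err: "(\<integral>\<^sup>+u. \<integral>\<^sup>+y. ?e u y \<partial>lborel \<partial>\<rho>) \<le> ennreal ?E"
    if "finite_measure \<rho>" "sets \<rho> = sets borel" "\<And>v. smoothed \<rho> T v \<le> ennreal B" "measure \<rho> (space \<rho>) \<le> m" for \<rho>
    using x T that kern_moment_nonneg B(1)
    by (intro order.trans[OF smoothing_error_le[OF that(1,2) T _ B(1) that(3)]] ennreal_leI divide_right_mono add_mono mult_left_mono) auto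
  have e_cong: "x * \<bar>u - (u - y/T)\<bar> + indicator {-\<bar>u - (u - y/T)\<bar>..\<bar>u - (u - y/T)\<bar>} u = blur x T u y" for u y
    using T by (simp add: blur_def)
  \<comment> \<open>For a single measure, replacing \<open>lap x u\<close> by its value at the
    displaced point costs at most \<open>blur\<close> in either direction.\<close>
  have NG: "?N \<rho> * ennreal kern_mass \<le> ?G \<rho> + ennreal ?E" "?G \<rho> \<le> ?N \<rho> * ennreal kern_mass + ennreal ?E"
    if \<rho>: "finite_measure \<rho>" and sets_rho[measurable_cong]: "sets \<rho> = sets borel" and B\<rho>: "\<And>v. smoothed \<rho> T v \<le> ennreal B"
      and m\<rho>: "measure \<rho> (space \<rho>) \<le> m" for \<rho>
  proof -
    interpret R: finite_measure \<rho> by fact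
    have N: "?N \<rho> * ennreal kern_mass = (\<integral>\<^sup>+u. \<integral>\<^sup>+y. ?f u * ennreal (kern y) \<partial>lborel \<partial>\<rho>)"
      by (simp add: nn_integral_cmult nn_integral_kern nn_integral_multc)
    have "(\<integral>\<^sup>+u. \<integral>\<^sup>+y. ?f u * ennreal (kern y) \<partial>lborel \<partial>\<rho>)
      \<le> (\<integral>\<^sup>+u. \<integral>\<^sup>+y. ennreal (lap x (u - y / T)) * ennreal (kern y) + ?e u y \<partial>lborel \<partial>\<rho>)"
    proof (intro nn_integral_mono)
      fix u y
      have "?f u \<le> ennreal (lap x (u - y / T) + (blur x T u y))"
        using lap_diff_le[of x u "u - y / T"] x unfolding e_cong by (intro ennreal_leI) simp
      also have "\<dots> = ennreal (lap x (u - y / T)) + ennreal (blur x T u y)"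
        using x T by (intro ennreal_plus) (auto intro: blur_nonneg)
      finally show "?f u * ennreal (kern y) \<le> ennreal (lap x (u - y / T)) * ennreal (kern y) + ?e u y"
        unfolding distrib_right[symmetric] by (rule mult_right_mono) simp
    qed
    also have "\<dots> = ?G \<rho> + (\<integral>\<^sup>+u. \<integral>\<^sup>+y. ?e u y \<partial>lborel \<partial>\<rho>)"
      by (subst nn_integral_add[symmetric]) (auto intro!: nn_integral_cong nn_integral_add)
    finally show "?N \<rho> * ennreal kern_mass \<le> ?G \<rho> + ennreal ?E"
      unfolding N using err[OF that] by (meson add_left_mono order.trans)
    have "?G \<rho> \<le> (\<integral>\<^sup>+u. \<integral>\<^sup>+y. ?f u * ennreal (kern y) + ?e u y \<partial>lborel \<partial>\<rho>)"
    proof (intro nn_integral_mono)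
      fix u y
      have "ennreal (lap x (u - y / T)) \<le> ennreal (lap x u + (blur x T u y))"
        using lap_diff_le[of x u "u - y / T"] x unfolding e_cong by (intro ennreal_leI) simp
      also have "\<dots> = ?f u + ennreal (blur x T u y)"
        using x T by (intro ennreal_plus) (auto intro: blur_nonneg)
      finally show "ennreal (lap x (u - y / T)) * ennreal (kern y) \<le> ?f u * ennreal (kern y) + ?e u y"
        unfolding distrib_right[symmetric] by (rule mult_right_mono) simp
    qed
    also have "\<dots> = (\<integral>\<^sup>+u. \<integral>\<^sup>+y. ?f u * ennreal (kern y) \<partial>lborel \<partial>\<rho>) + (\<integral>\<^sup>+u. \<integral>\<^sup>+y. ?e u y \<partial>lborel \<partial>\<rho>)"
      by (subst nn_integral_add[symmetric]) (auto intro!: nn_integral_cong nn_integral_add)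
    finally show "?G \<rho> \<le> ?N \<rho> * ennreal kern_mass + ennreal ?E"
      unfolding N using err[OF that] by (meson add_left_mono order.trans)
  qed
  have int: "integrable \<rho> (lap x)" if "finite_measure \<rho>" and [measurable_cong]: "sets \<rho> = sets borel" for \<rho>
  proof -
    interpret finite_measure \<rho> by fact
    show ?thesis using x by (intro integrable_const_bound[where B=1]) (auto simp: lap_le_1)
  qed
  have N_eq: "?N \<rho> = ennreal (LINT u|\<rho>. lap x u)" if "finite_measure \<rho>" "sets \<rho> = sets borel" for \<rho>
    by (intro nn_integral_eq_integral int that) auto
  have GG: "?G \<nu> \<le> ?G \<mu> + ennreal (D / (2 * x))"
  proof -
    interpret U: finite_measure \<mu> by fact
    note [measurable_cong] = s
    have [measurable]: "smoothed \<mu> T \<in> borel_measurable borel" unfolding smoothed_def[abs_def] by measurable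
    have "?G \<nu> = (\<integral>\<^sup>+v. ?f v * smoothed \<nu> T v \<partial>lborel)"
      by (rule nn_integral_lap_smoothed[symmetric]) fact+
    also have "\<dots> \<le> (\<integral>\<^sup>+v. ?f v * smoothed \<mu> T v + ?f v * ennreal (D / 2) \<partial>lborel)"
      unfolding distrib_left[symmetric]
      by (intro nn_integral_mono mult_left_mono smoothed_le_add[OF fin s T D0 D]) simp
    also have "\<dots> = (\<integral>\<^sup>+v. ?f v * smoothed \<mu> T v \<partial>lborel) + ennreal (1 / x) * ennreal (D / 2)"
      using x by (simp add: nn_integral_add nn_integral_multc nn_integral_lap)
    also have "(\<integral>\<^sup>+v. ?f v * smoothed \<mu> T v \<partial>lborel) = ?G \<mu>"
      by (rule nn_integral_lap_smoothed) fact+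
    also have "ennreal (1 / x) * ennreal (D / 2) = ennreal (D / (2 * x))"
      using x D0 by (subst ennreal_mult[symmetric]) (auto simp: mult.commute)
    finally show ?thesis .
  qed
  have "?N \<nu> * ennreal kern_mass \<le> ?G \<nu> + ennreal ?E"
    by (intro NG fin s B m)
  also have "\<dots> \<le> (?G \<mu> + ennreal (D / (2 * x))) + ennreal ?E"
    by (intro add_right_mono GG)
  also have "\<dots> \<le> ((?N \<mu> * ennreal kern_mass + ennreal ?E) + ennreal (D / (2 * x))) + ennreal ?E"
    by (intro add_right_mono NG fin s B m)
  also have "\<dots> = ennreal ((LINT u|\<mu>. lap x u) * kern_mass + ?E + D / (2 * x) + ?E)"
  proof -
    have sum: "ennreal p * ennreal k + ennreal e + ennreal d + ennreal e = ennreal (p * k + e + d + e)"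
      if "0 \<le> p" "0 \<le> k" "0 \<le> e" "0 \<le> d" for p k e d
      using that by (simp flip: ennreal_plus ennreal_mult)
    show ?thesis
      unfolding N_eq[OF fin(2) s(2)] using E0 x D0 kern_mass_pos
      by (intro sum integral_nonneg_AE) auto
  qed
  also have "?N \<nu> * ennreal kern_mass = ennreal ((LINT u|\<nu>. lap x u) * kern_mass)"
    using kern_mass_pos N_eq[OF fin(1) s(1)] by (simp add: ennreal_mult)
  finally have "(LINT u|\<nu>. lap x u) * kern_mass \<le> (LINT u|\<mu>. lap x u) * kern_mass + ?E + D / (2 * x) + ?E"
  proof (subst (asm) ennreal_le_iff)
    show "0 \<le> (LINT u|\<mu>. lap x u) * kern_mass + ?E + D / (2 * x) + ?E"
      by (intro add_nonneg_nonneg E0 mult_nonneg_nonneg integral_nonneg_AE) (use x D0 kern_mass_pos in auto)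
  qed
  then show ?thesis by (simp add: mult.commute add_ac)
qed

section \<open>Complex moment generating functions\<close>

text \<open>The remainder stays a series of nonnegative terms so that its expectation can be taken
  term by term, inserting a moment bound into each.\<close>

lemma norm_exp_minus_Taylor2_le:
  fixes w :: complex
  shows "ennreal (cmod (exp w - (1 + w + w\<^sup>2 / 2))) \<le> (\<Sum>j. ennreal (cmod w ^ (j + 3) / fact (j + 3)))"
proof -
  have "(\<lambda>n. w ^ n /\<^sub>R fact n) sums exp w" by (rule exp_converges)
  from sums_split_initial_segment[OF this, of 3]
  have 1: "(\<lambda>j. w ^ (j + 3) /\<^sub>R fact (j + 3)) sums (exp w - (1 + w + w\<^sup>2 / 2))"
    by (simp add: numeral_eq_Suc field_simps scaleR_conv_of_real)
  have "summable (\<lambda>n. cmod w ^ n /\<^sub>R fact n)" using exp_converges[of "cmod w"] by (rule sums_summable)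
  then have "summable (\<lambda>j. cmod w ^ (j + 3) /\<^sub>R fact (j + 3))"
    using summable_iff_shift[of "\<lambda>n. cmod w ^ n /\<^sub>R fact n" 3] by simp
  then have 2: "summable (\<lambda>j. cmod w ^ (j + 3) / fact (j + 3))"
    by (simp add: divide_inverse mult.commute)
  have nrm: "cmod (w ^ (j + 3) /\<^sub>R fact (j + 3)) = cmod w ^ (j + 3) / fact (j + 3)" for j
    by (simp add: norm_power norm_mult divide_inverse mult.commute del: fact_Suc power_Suc)
  have "cmod (exp w - (1 + w + w\<^sup>2 / 2)) \<le> (\<Sum>j. cmod w ^ (j + 3) / fact (j + 3))"
    using summable_norm[of "\<lambda>j. w ^ (j + 3) /\<^sub>R fact (j + 3)"] 2 sums_unique[OF 1]
    unfolding nrm by simp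
  then have "ennreal (cmod (exp w - (1 + w + w\<^sup>2 / 2))) \<le> ennreal (\<Sum>j. cmod w ^ (j + 3) / fact (j + 3))"
    by (rule ennreal_leI)
  also have "\<dots> = (\<Sum>j. ennreal (cmod w ^ (j + 3) / fact (j + 3)))"
    using 2 by (intro suminf_ennreal2[symmetric]) auto
  finally show ?thesis .
qed

text \<open>In the expected Taylor remainder the factorials cancel against those in the moment
  bounds, leaving a geometric series in \<open>q = \<kappa> * cmod z\<close>. The linear term
  vanishes because the mean is 0. Integrability follows since the exponential is the integrable
  remainder plus a quadratic polynomial in \<open>X\<close>.\<close>

lemma (in prob_space)
  fixes X :: "'a \<Rightarrow> real" and z :: complex and \<kappa> :: real
  assumes [measurable]: "random_variable borel X"
    and X: "integrable M X" "expectation X = 0" "integrable M (\<lambda>\<omega>. (X \<omega>)\<^sup>2)"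
    and mom: "\<And>j. 2 \<le> j \<Longrightarrow> (\<integral>\<^sup>+\<omega>. ennreal (\<bar>X \<omega>\<bar> ^ j) \<partial>M) \<le> ennreal (fact j * \<kappa> ^ j)"
    and \<kappa>: "0 \<le> \<kappa>" "\<kappa> * cmod z \<le> 1 / 4"
  shows integrable_exp_of_moments: "integrable M (\<lambda>\<omega>. exp (z * X \<omega>))"
    and mgf_second_order: "cmod ((CLINT \<omega>|M. exp (z * X \<omega>)) - (1 + z\<^sup>2 / 2 * expectation (\<lambda>\<omega>. (X \<omega>)\<^sup>2)))
      \<le> 2 * (\<kappa> * cmod z) ^ 3"
proof -
  define q where "q = \<kappa> * cmod z"
  have q: "0 \<le> q" "q \<le> 1/4" using \<kappa> by (auto simp: q_def)
  define R where "R \<omega> = exp (z * X \<omega>) - (1 + z * X \<omega> + (z * X \<omega>)\<^sup>2 / 2)" for \<omega>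
  have [measurable]: "R \<in> borel_measurable M" unfolding R_def[abs_def] by measurable
  have "(\<integral>\<^sup>+\<omega>. ennreal (cmod (R \<omega>)) \<partial>M)
     \<le> (\<integral>\<^sup>+\<omega>. (\<Sum>j. ennreal (cmod z ^ (j + 3) / fact (j + 3)) * ennreal (\<bar>X \<omega>\<bar> ^ (j + 3))) \<partial>M)"
    unfolding R_def
    by (intro nn_integral_mono order.trans[OF norm_exp_minus_Taylor2_le] eq_refl suminf_cong)
       (simp add: norm_mult power_mult_distrib flip: ennreal_mult del: power_Suc fact_Suc)
  also have "\<dots> = (\<Sum>j. ennreal (cmod z ^ (j + 3) / fact (j + 3)) * (\<integral>\<^sup>+\<omega>. ennreal (\<bar>X \<omega>\<bar> ^ (j + 3)) \<partial>M))"
    by (subst nn_integral_suminf) (auto simp: nn_integral_cmult)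
  also have "\<dots> \<le> (\<Sum>j. ennreal (cmod z ^ (j + 3) / fact (j + 3)) * ennreal (fact (j + 3) * \<kappa> ^ (j + 3)))"
    by (intro suminf_le mult_left_mono mom) auto
  also have "\<dots> = (\<Sum>j. ennreal (q ^ 3 * q ^ j))"
    using \<kappa> by (intro suminf_cong)
      (simp add: q_def power_mult_distrib power_add mult_ac flip: ennreal_mult del: power_Suc fact_Suc)
  also have "\<dots> = ennreal (q ^ 3 / (1 - q))"
  proof -
    have s: "(\<lambda>j. q ^ 3 * q ^ j) sums (q ^ 3 * (1 / (1 - q)))"
      using q by (intro sums_mult geometric_sums) auto
    show ?thesis
      using q s by (subst suminf_ennreal2) (auto simp: sums_iff)
  qed
  \<comment> \<open>Here 1 - q is at least 1/2, since q is at most 1/4.\<close>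
  also have "q ^ 3 / (1 - q) \<le> 2 * q ^ 3"
    using q mult_left_mono[of "1/2" "1 - q" "2 * q ^ 3"] by (simp add: pos_divide_le_eq mult_ac)
  finally have nnR: "(\<integral>\<^sup>+\<omega>. ennreal (cmod (R \<omega>)) \<partial>M) \<le> ennreal (2 * q ^ 3)"
    by (simp add: ennreal_leI)
  have intR: "integrable M R"
    using nnR by (intro integrableI_bounded) (auto intro: le_less_trans)
  have "ennreal (cmod (integral\<^sup>L M R)) \<le> (\<integral>\<^sup>+\<omega>. ennreal (cmod (R \<omega>)) \<partial>M)"
    by (rule integral_norm_bound_ennreal[OF intR])
  from order.trans[OF this nnR] have bd: "cmod (integral\<^sup>L M R) \<le> 2 * q ^ 3"
    using q by (subst (asm) ennreal_le_iff) auto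
  have intc: "complex_integrable M (\<lambda>\<omega>. of_real (X \<omega>))" "complex_integrable M (\<lambda>\<omega>. of_real ((X \<omega>)\<^sup>2))"
    using X by (auto intro: integrable_of_real simp del: of_real_power)
  have eq: "exp (z * X \<omega>) = R \<omega> + (1 + z * of_real (X \<omega>) + z\<^sup>2 / 2 * of_real ((X \<omega>)\<^sup>2))" for \<omega>
    by (simp add: R_def power_mult_distrib)
  show "integrable M (\<lambda>\<omega>. exp (z * X \<omega>))"
    unfolding eq using intR intc by (intro Bochner_Integration.integrable_add integrable_mult_right) auto
  have "(CLINT \<omega>|M. exp (z * X \<omega>)) = integral\<^sup>L M R + (1 + z * of_real (expectation X) + z\<^sup>2 / 2 * of_real (expectation (\<lambda>\<omega>. (X \<omega>)\<^sup>2)))"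
    unfolding eq using intR intc
    by (simp add: prob_space del: of_real_power)
  then show "cmod ((CLINT \<omega>|M. exp (z * X \<omega>)) - (1 + z\<^sup>2 / 2 * expectation (\<lambda>\<omega>. (X \<omega>)\<^sup>2)))
      \<le> 2 * (\<kappa> * cmod z) ^ 3"
    using bd by (simp add: X q_def)
qed

lemma (in prob_space) second_moment_le:
  fixes X :: "'a \<Rightarrow> real"
  assumes "integrable M (\<lambda>\<omega>. (X \<omega>)\<^sup>2)"
    and mom: "(\<integral>\<^sup>+\<omega>. ennreal (\<bar>X \<omega>\<bar> ^ 2) \<partial>M) \<le> ennreal (fact 2 * \<kappa> ^ 2)"
  shows "expectation (\<lambda>\<omega>. (X \<omega>)\<^sup>2) \<le> 2 * \<kappa>\<^sup>2"
proof -
  have "ennreal (expectation (\<lambda>\<omega>. (X \<omega>)\<^sup>2)) = (\<integral>\<^sup>+\<omega>. ennreal (\<bar>X \<omega>\<bar> ^ 2) \<partial>M)"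
    using assms(1) by (subst nn_integral_eq_integral) auto
  also have "\<dots> \<le> ennreal (2 * \<kappa>\<^sup>2)" using mom by (simp add: fact_numeral)
  finally show ?thesis by (subst (asm) ennreal_le_iff) auto
qed

text \<open>The transform is 1 + w with w small, so its principal logarithm is available. The error
  splits into the logarithm's deviation from w and the second-order remainder, each at most 2 q^3.
  In exponential form, products over independent summands become sums of errors.\<close>

lemma (in prob_space) mgf_eq_exp:
  fixes X :: "'a \<Rightarrow> real" and z :: complex and \<kappa> :: real
  assumes rv: "random_variable borel X"
    and X: "integrable M X" "expectation X = 0" "integrable M (\<lambda>\<omega>. (X \<omega>)\<^sup>2)"
    and mom: "\<And>j. 2 \<le> j \<Longrightarrow> (\<integral>\<^sup>+\<omega>. ennreal (\<bar>X \<omega>\<bar> ^ j) \<partial>M) \<le> ennreal (fact j * \<kappa> ^ j)"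
    and \<kappa>: "0 \<le> \<kappa>" "\<kappa> * cmod z \<le> 1 / 4"
  shows "\<exists>\<rho>. cmod \<rho> \<le> 4 * (\<kappa> * cmod z) ^ 3 \<and>
    (CLINT \<omega>|M. exp (z * X \<omega>)) = exp (z\<^sup>2 / 2 * expectation (\<lambda>\<omega>. (X \<omega>)\<^sup>2) + \<rho>)"
proof -
  define q where "q = \<kappa> * cmod z"
  have q: "0 \<le> q" "q \<le> 1/4" using \<kappa> by (auto simp: q_def)
  define s where "s = expectation (\<lambda>\<omega>. (X \<omega>)\<^sup>2)"
  have s: "0 \<le> s" "s \<le> 2 * \<kappa>\<^sup>2"
    using second_moment_le[OF X(3) mom] by (auto simp: s_def)
  define w where "w = (CLINT \<omega>|M. exp (z * X \<omega>)) - 1"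
  define R where "R = w - z\<^sup>2 / 2 * s"
  have R: "cmod R \<le> 2 * q ^ 3"
    using mgf_second_order[OF rv X mom \<kappa>] by (simp add: R_def w_def s_def q_def algebra_simps)
  have "cmod (z\<^sup>2 / 2 * s) = cmod z ^ 2 * s / 2" using s by (simp add: norm_mult norm_power norm_divide)
  also have "\<dots> \<le> cmod z ^ 2 * (2 * \<kappa>\<^sup>2) / 2" using s by (intro divide_right_mono mult_left_mono) auto
  also have "\<dots> = q\<^sup>2" by (simp add: q_def power_mult_distrib)
  finally have zs: "cmod (z\<^sup>2 / 2 * s) \<le> q\<^sup>2" .
  have q3: "q ^ 3 \<le> 1/4 * q\<^sup>2" using q mult_right_mono[of q "1/4" "q\<^sup>2"] by (simp add: power_numeral_reduce)
  have q2: "q\<^sup>2 \<le> 1/16" using q power_mono[of q "1/4" 2] by (simp add: power2_eq_square)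
  have "cmod w \<le> cmod (z\<^sup>2 / 2 * s) + cmod R"
    using norm_triangle_ineq[of "z\<^sup>2 / 2 * s" R] by (simp add: R_def)
  \<comment> \<open>The two parts are at most q^2 and 2 q^3, and 2 q^3 is at most q^2/2.\<close>
  then have w: "cmod w \<le> 3/2 * q\<^sup>2" using zs R q3 by linarith
  then have w1: "cmod w \<le> 1/2" using q2 by linarith
  have "cmod w ^ 2 \<le> (3/2 * q\<^sup>2)\<^sup>2" using w by (intro power_mono) auto
  also have "\<dots> = 9/4 * q * q ^ 3" by (simp add: power_numeral_reduce)
  also have "\<dots> \<le> 9/4 * (1/4) * q ^ 3" using q by (intro mult_right_mono mult_left_mono) auto
  finally have w2: "cmod w ^ 2 \<le> q ^ 3" using zero_le_power[OF q(1), of 3] by linarith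
  have "cmod (ln (1 + w) - w) \<le> cmod w ^ 2 / (1 - cmod w)"
    using w1 by (intro Ln_approx_linear) auto
  also have "\<dots> \<le> q ^ 3 / (1/2)" using w1 w2 q by (intro frac_le) auto
  finally have L: "cmod (ln (1 + w) - w) \<le> 2 * q ^ 3" by simp
  have "1 + w \<noteq> 0"
  proof
    assume "1 + w = 0"
    then have "w = - 1" by (simp add: eq_neg_iff_add_eq_0 add.commute)
    then show False using w1 by simp
  qed
  define \<rho> where "\<rho> = ln (1 + w) - z\<^sup>2 / 2 * s"
  have "cmod \<rho> \<le> 4 * q ^ 3"
    using norm_triangle_ineq[of "ln (1 + w) - w" R] L R by (simp add: \<rho>_def R_def)
  moreover have "(CLINT \<omega>|M. exp (z * X \<omega>)) = exp (z\<^sup>2 / 2 * s + \<rho>)"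
    using \<open>1 + w \<noteq> 0\<close> by (simp add: \<rho>_def w_def)
  ultimately show ?thesis unfolding q_def s_def by blast
qed

text \<open>Independence factorises the transform. The exponents add, so the error is at most
  \<open>card I\<close> times the bound for one summand.\<close>

lemma (in prob_space)
  fixes X :: "'i \<Rightarrow> 'a \<Rightarrow> real" and z :: complex and \<kappa> :: real
  assumes ind: "indep_vars (\<lambda>_. borel) X I" and fin: "finite I"
    and X: "\<And>i. i \<in> I \<Longrightarrow> integrable M (X i)" "\<And>i. i \<in> I \<Longrightarrow> expectation (X i) = 0"
      "\<And>i. i \<in> I \<Longrightarrow> integrable M (\<lambda>\<omega>. (X i \<omega>)\<^sup>2)"
    and mom: "\<And>i j. i \<in> I \<Longrightarrow> 2 \<le> j \<Longrightarrow> (\<integral>\<^sup>+\<omega>. ennreal (\<bar>X i \<omega>\<bar> ^ j) \<partial>M) \<le> ennreal (fact j * \<kappa> ^ j)"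
    and \<kappa>: "0 \<le> \<kappa>" "\<kappa> * cmod z \<le> 1 / 4"
  shows integrable_exp_indep_sum: "integrable M (\<lambda>\<omega>. exp (z * (\<Sum>i\<in>I. X i \<omega>)))"
    and mgf_indep_sum: "\<exists>\<eta>. cmod \<eta> \<le> 4 * (card I * \<kappa> ^ 3) * cmod z ^ 3 \<and>
    (CLINT \<omega>|M. exp (z * (\<Sum>i\<in>I. X i \<omega>))) = exp (z\<^sup>2 / 2 * (\<Sum>i\<in>I. expectation (\<lambda>\<omega>. (X i \<omega>)\<^sup>2)) + \<eta>)"
proof -
  have rv: "random_variable borel (X i)" if "i \<in> I" for i
    using ind that by (auto simp: indep_vars_def)
  have int: "integrable M (\<lambda>\<omega>. exp (z * X i \<omega>))" if "i \<in> I" for i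
    by (rule integrable_exp_of_moments[OF rv X mom \<kappa>]) (use that in auto)
  have ind': "indep_vars (\<lambda>_. borel) (\<lambda>i \<omega>. exp (z * complex_of_real (X i \<omega>))) I"
    by (rule indep_vars_compose2[OF ind]) measurable
  have prod: "exp (z * (\<Sum>i\<in>I. X i \<omega>)) = (\<Prod>i\<in>I. exp (z * complex_of_real (X i \<omega>)))" for \<omega>
    using fin by (simp add: sum_distrib_left exp_sum)
  show "integrable M (\<lambda>\<omega>. exp (z * (\<Sum>i\<in>I. X i \<omega>)))"
    unfolding prod by (rule indep_vars_integrable[OF fin ind' int])
  have "\<exists>\<rho>. \<forall>i\<in>I. cmod (\<rho> i) \<le> 4 * (\<kappa> * cmod z) ^ 3 \<and>
    (CLINT \<omega>|M. exp (z * X i \<omega>)) = exp (z\<^sup>2 / 2 * expectation (\<lambda>\<omega>. (X i \<omega>)\<^sup>2) + \<rho> i)"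
    by (intro bchoice ballI mgf_eq_exp[OF rv X mom \<kappa>]) auto
  then obtain \<rho> where \<rho>: "\<And>i. i \<in> I \<Longrightarrow> cmod (\<rho> i) \<le> 4 * (\<kappa> * cmod z) ^ 3"
    "\<And>i. i \<in> I \<Longrightarrow> (CLINT \<omega>|M. exp (z * X i \<omega>)) = exp (z\<^sup>2 / 2 * expectation (\<lambda>\<omega>. (X i \<omega>)\<^sup>2) + \<rho> i)"
    by blast
  have "(CLINT \<omega>|M. exp (z * (\<Sum>i\<in>I. X i \<omega>))) = (\<Prod>i\<in>I. CLINT \<omega>|M. exp (z * X i \<omega>))"
    unfolding prod by (rule indep_vars_lebesgue_integral[OF fin ind' int])
  also have "\<dots> = exp (\<Sum>i\<in>I. z\<^sup>2 / 2 * expectation (\<lambda>\<omega>. (X i \<omega>)\<^sup>2) + \<rho> i)"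
    using fin \<rho>(2) by (simp add: exp_sum)
  also have "(\<Sum>i\<in>I. z\<^sup>2 / 2 * expectation (\<lambda>\<omega>. (X i \<omega>)\<^sup>2) + \<rho> i)
    = z\<^sup>2 / 2 * (\<Sum>i\<in>I. expectation (\<lambda>\<omega>. (X i \<omega>)\<^sup>2)) + sum \<rho> I"
    by (simp add: sum.distrib sum_distrib_left)
  finally have 1: "(CLINT \<omega>|M. exp (z * (\<Sum>i\<in>I. X i \<omega>))) = exp (z\<^sup>2 / 2 * (\<Sum>i\<in>I. expectation (\<lambda>\<omega>. (X i \<omega>)\<^sup>2)) + sum \<rho> I)" .
  have "cmod (sum \<rho> I) \<le> of_nat (card I) * (4 * (\<kappa> * cmod z) ^ 3)"
    by (rule sum_norm_bound[OF \<rho>(1)])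
  then have "cmod (sum \<rho> I) \<le> 4 * (card I * \<kappa> ^ 3) * cmod z ^ 3"
    by (simp add: power_mult_distrib mult_ac)
  with 1 show "\<exists>\<eta>. cmod \<eta> \<le> 4 * (card I * \<kappa> ^ 3) * cmod z ^ 3 \<and>
    (CLINT \<omega>|M. exp (z * (\<Sum>i\<in>I. X i \<omega>))) = exp (z\<^sup>2 / 2 * (\<Sum>i\<in>I. expectation (\<lambda>\<omega>. (X i \<omega>)\<^sup>2)) + \<eta>)"
    by blast
qed

section \<open>Exponential tilting\<close>

text \<open>The weight is normalised by the Gaussian moment generating function, so the result is in
  general not a probability measure. A standard normal \<open>W\<close> would again yield the
  standard normal law.\<close>

definition tilted :: "'a measure \<Rightarrow> ('a \<Rightarrow> real) \<Rightarrow> real \<Rightarrow> real measure" where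
  "tilted M W x = distr (density M (\<lambda>\<omega>. ennreal (exp (x * W \<omega> - x\<^sup>2 / 2)))) borel (\<lambda>\<omega>. W \<omega> - x)"

lemma sets_tilted [simp]: "sets (tilted M W x) = sets borel"
  by (simp add: tilted_def)

lemma space_tilted [simp]: "space (tilted M W x) = UNIV"
  by (simp add: tilted_def)

lemma integral_tilted:
  fixes f :: "real \<Rightarrow> 'b::{banach, second_countable_topology}"
  assumes [measurable]: "W \<in> borel_measurable M" "f \<in> borel_measurable borel"
  shows "integral\<^sup>L (tilted M W x) f = (\<integral>\<omega>. exp (x * W \<omega> - x\<^sup>2 / 2) *\<^sub>R f (W \<omega> - x) \<partial>M)"
  unfolding tilted_def by (simp add: integral_distr integral_density)

lemma finite_measure_tilted:
  assumes [measurable]: "W \<in> borel_measurable M" and int: "integrable M (\<lambda>\<omega>. exp (x * W \<omega>))"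
  shows "finite_measure (tilted M W x)"
proof
  have "integrable M (\<lambda>\<omega>. exp (x * W \<omega> - x\<^sup>2 / 2))"
    using int by (simp add: exp_diff)
  then have "(\<integral>\<^sup>+\<omega>. ennreal (exp (x * W \<omega> - x\<^sup>2 / 2)) \<partial>M) \<noteq> \<infinity>"
    by (subst nn_integral_eq_integral) auto
  moreover have "emeasure (tilted M W x) (space (tilted M W x)) = (\<integral>\<^sup>+\<omega>. ennreal (exp (x * W \<omega> - x\<^sup>2 / 2)) \<partial>M)"
    unfolding tilted_def by (subst emeasure_distr) (auto simp: emeasure_density cong: nn_integral_cong)
  ultimately show "emeasure (tilted M W x) (space (tilted M W x)) \<noteq> \<infinity>" by simp
qed

lemma char_tilted:
  assumes [measurable]: "W \<in> borel_measurable M"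
  shows "char (tilted M W x) t = exp (- (x\<^sup>2 / 2) - \<i> * t * x) * (CLINT \<omega>|M. exp (Complex x t * W \<omega>))"
proof -
  have "char (tilted M W x) t = (CLINT \<omega>|M. exp (x * W \<omega> - x\<^sup>2 / 2) *\<^sub>R iexp (t * (W \<omega> - x)))"
    unfolding char_def by (subst integral_tilted) auto
  also have "\<dots> = (CLINT \<omega>|M. exp (- (x\<^sup>2 / 2) - \<i> * t * x) * exp (Complex x t * W \<omega>))"
    by (intro Bochner_Integration.integral_cong refl)
       (simp add: scaleR_conv_of_real Complex_eq algebra_simps flip: exp_of_real exp_add)
  finally show ?thesis by simp
qed

text \<open>On the event, the tilting weight times exp(-x (W - x)) is the constant exp(x^2/2), so
  the random factors cancel.\<close>

lemma lap_tilted: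
  assumes "finite_measure M" and [measurable]: "W \<in> borel_measurable M"
  shows "measure M {\<omega> \<in> space M. x < W \<omega>} = exp (- (x\<^sup>2 / 2)) * (LINT u|tilted M W x. lap x u)"
proof -
  interpret finite_measure M by fact
  define A where "A = {\<omega> \<in> space M. x < W \<omega>}"
  have A: "A \<inter> space M = A" by (auto simp: A_def)
  have "(LINT u|tilted M W x. lap x u) = (LINT \<omega>|M. exp (x\<^sup>2 / 2) * indicator A \<omega>)"
    by (subst integral_tilted) (auto intro!: Bochner_Integration.integral_cong
      simp: A_def lap_def indicator_def algebra_simps power2_eq_square simp flip: exp_add)
  also have "\<dots> = exp (x\<^sup>2 / 2) * measure M A"
    by (simp add: A)
  finally show ?thesis by (simp add: exp_minus A_def)
qed

section \<open>The Gaussian counterparts: tail, lower bound, smoothed density\<close>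

lemma integral_std_normal:
  fixes f :: "real \<Rightarrow> real"
  assumes [measurable]: "f \<in> borel_measurable borel"
  shows "integral\<^sup>L std_normal_distribution f = (LBINT u. std_normal_density u * f u)"
  by (subst integral_density) auto

lemma std_normal_tail_eq:
  "1 - cdf std_normal_distribution x = exp (- (x\<^sup>2 / 2)) * (LINT u|std_normal_distribution. lap x u)"
proof -
  interpret real_distribution std_normal_distribution by (rule real_dist_normal_dist)
  have "1 - cdf std_normal_distribution x = measure std_normal_distribution {x<..}"
    using prob_compl[of "{..x}"] by (simp add: cdf_def Compl_eq_Diff_UNIV[symmetric] Compl_atMost)
  also have "\<dots> = (LINT v|std_normal_distribution. indicator {x<..} v)"
    by simp
  also have "\<dots> = (LBINT v. std_normal_density v * indicator {x<..} v)"
    by (rule integral_std_normal) measurable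
  also have "\<dots> = (LBINT u. std_normal_density (x + 1 * u) * indicator {x<..} (x + 1 * u))"
    by (subst lborel_integral_real_affine[where c=1 and t=x]) auto
  also have "\<dots> = (LBINT u. exp (- (x\<^sup>2 / 2)) * (std_normal_density u * lap x u))"
    by (intro Bochner_Integration.integral_cong refl)
       (auto simp: std_normal_density_def lap_def indicator_def field_simps power2_eq_square simp flip: exp_add)
  also have "\<dots> = exp (- (x\<^sup>2 / 2)) * (LINT u|std_normal_distribution. lap x u)"
    by (subst integral_std_normal) auto
  finally show ?thesis .
qed

text \<open>Only u in (0, 1/x] is kept: there \<open>lap x u\<close> is at least exp(-1), and u is
  at most 1, so the density is at least its value at 1.\<close>

lemma lap_std_normal_ge:
  assumes x: "1 \<le> x"
  shows "exp (- 1) * std_normal_density 1 / x \<le> (LINT u|std_normal_distribution. lap x u)"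
proof -
  define c where "c = exp (- 1) * std_normal_density 1"
  have c: "0 \<le> c" by (simp add: c_def)
  have "ennreal (c / x) = ennreal c * ennreal (1 / x)"
    using x c by (subst ennreal_mult[symmetric]) auto
  also have "\<dots> = (\<integral>\<^sup>+u. ennreal c * indicator {0<..1/x} u \<partial>lborel)"
    using x by (subst nn_integral_cmult_indicator) auto
  also have "\<dots> \<le> (\<integral>\<^sup>+u. ennreal (std_normal_density u * lap x u) \<partial>lborel)"
  proof (rule nn_integral_mono)
    fix u
    show "ennreal c * indicator {0<..1/x} u \<le> ennreal (std_normal_density u * lap x u)"
    proof (cases "u \<in> {0<..1/x}")
      case True
      then have u: "0 < u" "u * x \<le> 1" using x by (auto simp: field_simps)
      have "u * 1 \<le> u * x" using u x by (intro mult_left_mono) auto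
      then have "u \<le> 1" using u by linarith
      then have "u\<^sup>2 \<le> 1" using u by (simp add: abs_square_le_1)
      then have "std_normal_density 1 \<le> std_normal_density u"
        by (auto simp: std_normal_density_def intro!: divide_right_mono mult_left_mono)
      moreover have "exp (- 1) \<le> lap x u" using u by (auto simp: lap_def mult.commute)
      ultimately have "c \<le> std_normal_density u * lap x u"
        unfolding c_def by (subst mult.commute) (intro mult_mono, auto)
      then show ?thesis using True by (simp add: ennreal_leI)
    qed simp
  qed
  also have "\<dots> = (\<integral>\<^sup>+u. ennreal (lap x u) \<partial>std_normal_distribution)"
    by (subst nn_integral_density) (auto simp: ennreal_mult)
  also have "\<dots> = ennreal (LINT u|std_normal_distribution. lap x u)"
  proof -
    interpret real_distribution std_normal_distribution by (rule real_dist_normal_dist)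
    have "integrable std_normal_distribution (lap x)"
      using x by (intro integrable_const_bound[where B=1]) (auto simp: lap_le_1)
    then show ?thesis by (intro nn_integral_eq_integral) auto
  qed
  finally show ?thesis
    unfolding c_def by (subst (asm) ennreal_le_iff) (auto intro!: integral_nonneg_AE)
qed

text \<open>The normal density is at most 1, and the rescaled kernel integrates to
  \<open>kern_mass\<close> for every \<open>T\<close>.\<close>

lemma smoothed_std_normal_le:
  assumes T: "0 < T"
  shows "smoothed std_normal_distribution T v \<le> ennreal kern_mass"
proof -
  have d: "std_normal_density u \<le> 1" for u
  proof -
    have "1 \<le> sqrt (2 * pi)" using pi_ge_two by (simp add: real_le_rsqrt)
    then show ?thesis
      by (auto simp: std_normal_density_def divide_simps intro: order.trans[of _ 1])
  qed
  have "smoothed std_normal_distribution T v = (\<integral>\<^sup>+u. ennreal (std_normal_density u) * ennreal (T * kern (T * (u - v))) \<partial>lborel)"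
    unfolding smoothed_def by (subst nn_integral_density) auto
  also have "\<dots> \<le> (\<integral>\<^sup>+u. 1 * ennreal (T * kern (T * (u - v))) \<partial>lborel)"
    by (intro nn_integral_mono mult_right_mono) (auto simp: d)
  also have "\<dots> = (\<integral>\<^sup>+u. ennreal (T * kern (- (T * v) + T * u)) \<partial>lborel)"
    by (simp add: algebra_simps)
  also have "\<dots> = ennreal T * (\<integral>\<^sup>+u. ennreal (kern (- (T * v) + T * u)) \<partial>lborel)"
    using T by (subst nn_integral_cmult[symmetric]) (auto simp: ennreal_mult)
  also have "\<dots> = (\<integral>\<^sup>+u. ennreal (kern u) \<partial>lborel)"
    using T by (subst nn_integral_real_affine[of _ T "- (T * v)"]) auto
  finally show ?thesis by (simp add: nn_integral_kern)
qed

text \<open>Comparing power series gives exp(s) - 1 with s = \<open>cmod z\<close>; multiplying 1 -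
  s <= exp(-s) by exp(s) bounds this by s exp(s).\<close>

lemma norm_exp_minus_one_le:
  fixes z :: complex
  shows "cmod (exp z - 1) \<le> cmod z * exp (cmod z)"
proof -
  have "(\<lambda>n. z ^ n /\<^sub>R fact n) sums exp z" by (rule exp_converges)
  from sums_split_initial_segment[OF this, of 1]
  have 1: "(\<lambda>j. z ^ (j + 1) /\<^sub>R fact (j + 1)) sums (exp z - 1)" by simp
  from sums_split_initial_segment[OF exp_converges[of "cmod z"], of 1]
  have 2: "(\<lambda>j. cmod z ^ (j + 1) /\<^sub>R fact (j + 1)) sums (exp (cmod z) - 1)" by simp
  have nrm: "cmod (z ^ (j + 1) /\<^sub>R fact (j + 1)) = cmod z ^ (j + 1) /\<^sub>R fact (j + 1)" for j
    by (simp add: norm_power norm_mult divide_inverse mult.commute del: fact_Suc power_Suc)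
  have "cmod (exp z - 1) \<le> exp (cmod z) - 1"
    using summable_norm[of "\<lambda>j. z ^ (j + 1) /\<^sub>R fact (j + 1)"] 1 2
    unfolding nrm by (simp add: sums_iff)
  also have "\<dots> \<le> cmod z * exp (cmod z)"
    using mult_left_mono[OF exp_ge_add_one_self[of "- cmod z"], of "exp (cmod z)"]
    by (simp add: exp_minus algebra_simps)
  finally show ?thesis .
qed

text \<open>The exponent has 4 in place of 2 because half of the Gaussian decay is spent on the
  error factor exp(\<open>cmod \<eta>\<close>) in \<open>tail_ratio_bound\<close>.\<close>

definition gauss_moment :: real where
  "gauss_moment = (LBINT t. (1 + \<bar>t\<bar> ^ 3) * exp (- (t\<^sup>2 / 4)))"

lemma nn_integral_gauss_moment:
  "(\<integral>\<^sup>+t. ennreal ((1 + \<bar>t\<bar> ^ 3) * exp (- (t\<^sup>2 / 4))) \<partial>lborel) = ennreal gauss_moment"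
proof -
  \<comment> \<open>The function is a multiple of the normal density of variance 2.\<close>
  have eq: "exp (- (t\<^sup>2 / 4)) = sqrt (4 * pi) * normal_density 0 (sqrt 2) t" for t :: real
    by (simp add: normal_density_def)
  have "integrable lborel (\<lambda>t. sqrt (4 * pi) * (normal_density 0 (sqrt 2) t * \<bar>t - 0\<bar> ^ 0 + normal_density 0 (sqrt 2) t * \<bar>t - 0\<bar> ^ 3))"
    by (intro integrable_mult_right Bochner_Integration.integrable_add integrable_normal_moment_abs) auto
  then have "integrable lborel (\<lambda>t::real. (1 + \<bar>t\<bar> ^ 3) * exp (- (t\<^sup>2 / 4)))"
    unfolding eq by (simp add: algebra_simps)
  then show ?thesis unfolding gauss_moment_def by (intro nn_integral_eq_integral) auto
qed

lemma gauss_moment_nonneg: "0 \<le> gauss_moment"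
  unfolding gauss_moment_def by (intro integral_nonneg_AE) auto

section \<open>Moderate deviations\<close>

text \<open>The 16 comes from \<open>D / (2 * x)\<close>, the 512 from 2/T with T = 1/(256 L), the 2
  from the mass bound, and \<open>kern_mass + gauss_moment\<close> bounds both smoothed densities.
  The denominator is the kernel mass times the constant of \<open>lap_std_normal_ge\<close>.\<close>

definition cramer_const :: real where
  "cramer_const = (16 * gauss_moment + 512 * (2 * kern_moment + 16 * (kern_mass + gauss_moment) * (kern_moment + kern_mass)))
    / (kern_mass * (exp (- 1) * std_normal_density 1))"

text \<open>On the range of \<open>t\<close> allowed in \<open>char\<close>, the cubic error term
  stays below t^2/4, so the difference of characteristic functions is integrable with total O(L
  x^3). \<open>smoothing_inequality\<close>, applied in both directions, turns this into an O(L x^2)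
  difference of integrals, and the Gaussian one is at least of order 1/x.\<close>

lemma tail_ratio_bound:
  fixes \<nu> :: "real measure" and L x :: real
  assumes fin: "finite_measure \<nu>" and s: "sets \<nu> = sets borel"
    and x: "1 \<le> x" and L: "0 < L" "L * x ^ 3 \<le> 1 / 512"
    and char: "\<And>t. \<bar>t\<bar> \<le> 1 / (64 * L) \<Longrightarrow>
      \<exists>\<eta>. cmod \<eta> \<le> 4 * L * (x + \<bar>t\<bar>) ^ 3 \<and> char \<nu> t = exp (complex_of_real (- (t\<^sup>2 / 2)) + \<eta>)"
  shows "\<bar>(LINT u|\<nu>. lap x u) / (LINT u|std_normal_distribution. lap x u) - 1\<bar> \<le> cramer_const * (L * x ^ 3)"
proof -
  interpret V: finite_measure \<nu> by fact
  interpret G: real_distribution std_normal_distribution by (rule real_dist_normal_dist)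
  let ?\<gamma> = std_normal_distribution
  \<comment> \<open>Chosen so that the Fourier window \<open>4 * T\<close> is exactly the range
    where \<open>char\<close> applies.\<close>
  define T where "T = 1 / (256 * L)"
  have T: "0 < T" using L by (simp add: T_def)
  have T4: "4 * T = 1 / (64 * L)" by (simp add: T_def)
  define D where "D = 32 * L * x ^ 3 * gauss_moment"
  have D0: "0 \<le> D" using L x gauss_moment_nonneg by (simp add: D_def)
  have diff: "cmod (char \<nu> t - char ?\<gamma> t) \<le> 32 * L * x ^ 3 * ((1 + \<bar>t\<bar> ^ 3) * exp (- (t\<^sup>2 / 4)))"
    if t: "\<bar>t\<bar> \<le> 4 * T" for t
  proof -
    obtain \<eta> :: complex where \<eta>: "cmod \<eta> \<le> 4 * L * (x + \<bar>t\<bar>) ^ 3" "char \<nu> t = exp (complex_of_real (- (t\<^sup>2 / 2)) + \<eta>)"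
      using char[of t] t unfolding T4 by blast
    have "(x + \<bar>t\<bar>) ^ 3 \<le> 4 * (x ^ 3 + \<bar>t\<bar> ^ 3)"
    proof -
      have "4 * (x ^ 3 + \<bar>t\<bar> ^ 3) - (x + \<bar>t\<bar>) ^ 3 = 3 * (x + \<bar>t\<bar>) * (x - \<bar>t\<bar>)\<^sup>2"
        by (simp only: power3_eq_cube power2_eq_square ring_distribs) (simp add: algebra_simps)
      then show ?thesis using x by (smt (verit) mult_nonneg_nonneg zero_le_power2 abs_ge_zero)
    qed
    then have "4 * L * (x + \<bar>t\<bar>) ^ 3 \<le> 4 * L * (4 * (x ^ 3 + \<bar>t\<bar> ^ 3))"
      using L by (intro mult_left_mono) auto
    then have e1: "cmod \<eta> \<le> 16 * L * (x ^ 3 + \<bar>t\<bar> ^ 3)"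
      using \<eta>(1) by linarith
    have "\<bar>t\<bar> * (64 * L) \<le> 1" using t L unfolding T4 by (simp add: pos_le_divide_eq)
    then have "16 * L * \<bar>t\<bar> ^ 3 \<le> 1/4 * t\<^sup>2"
      using mult_right_mono[of "\<bar>t\<bar> * (64 * L)" 1 "t\<^sup>2 / 4"] by (simp add: power3_eq_cube power2_eq_square abs_mult_self_eq algebra_simps)
    \<comment> \<open>The summand 1/32 is 16 times the bound 1/512 on L x^3.\<close>
    then have e2: "cmod \<eta> \<le> 1/32 + t\<^sup>2 / 4"
      using e1 L(2) by (simp add: ring_distribs)
    have "exp (cmod \<eta>) \<le> exp (1/32) * exp (t\<^sup>2 / 4)"
      using e2 by (simp flip: exp_add)
    also have "exp (1/32) \<le> (2::real)"
      using exp_bound[of "1/32"] by (simp add: power2_eq_square)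
    finally have e3: "exp (cmod \<eta>) \<le> 2 * exp (t\<^sup>2 / 4)" by simp
    have "char \<nu> t - char ?\<gamma> t = exp (- (t\<^sup>2 / 2)) * (exp \<eta> - 1)"
      unfolding \<eta>(2) char_std_normal_distribution exp_add exp_of_real
      by (simp add: algebra_simps)
    then have "cmod (char \<nu> t - char ?\<gamma> t) = exp (- (t\<^sup>2 / 2)) * cmod (exp \<eta> - 1)"
      by (simp add: norm_mult)
    also have "\<dots> \<le> exp (- (t\<^sup>2 / 2)) * (cmod \<eta> * exp (cmod \<eta>))"
      by (intro mult_left_mono norm_exp_minus_one_le) auto
    also have "\<dots> \<le> exp (- (t\<^sup>2 / 2)) * ((16 * L * (x ^ 3 + \<bar>t\<bar> ^ 3)) * (2 * exp (t\<^sup>2 / 4)))"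
      using e1 e3 L x by (intro mult_left_mono mult_mono) auto
    also have "\<dots> = 32 * L * (x ^ 3 + \<bar>t\<bar> ^ 3) * (exp (- (t\<^sup>2 / 2)) * exp (t\<^sup>2 / 4))"
      by (simp add: mult_ac)
    also have "exp (- (t\<^sup>2 / 2)) * exp (t\<^sup>2 / 4) = exp (- (t\<^sup>2 / 4))"
      by (simp flip: exp_add)
    also have "32 * L * (x ^ 3 + \<bar>t\<bar> ^ 3) * exp (- (t\<^sup>2 / 4)) \<le> 32 * L * (x ^ 3 * (1 + \<bar>t\<bar> ^ 3)) * exp (- (t\<^sup>2 / 4))"
    proof -
      have "1 * \<bar>t\<bar> ^ 3 \<le> x ^ 3 * \<bar>t\<bar> ^ 3" using x by (intro mult_right_mono one_le_power) auto
      then show ?thesis using L by (intro mult_right_mono mult_left_mono) (auto simp: ring_distribs)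
    qed
    finally show ?thesis by (simp add: algebra_simps)
  qed
  have "(\<integral>\<^sup>+t. ennreal (cmod (char \<nu> t - char ?\<gamma> t)) * indicator {-4*T..4*T} t \<partial>lborel)
    \<le> (\<integral>\<^sup>+t. ennreal (32 * L * x ^ 3) * ennreal ((1 + \<bar>t\<bar> ^ 3) * exp (- (t\<^sup>2 / 4))) \<partial>lborel)"
    using diff L x by (intro nn_integral_mono)
      (auto intro!: ennreal_leI simp: abs_le_iff simp flip: ennreal_mult split: split_indicator)
  also have "\<dots> = ennreal D"
    using L x gauss_moment_nonneg
    by (subst nn_integral_cmult) (auto simp: nn_integral_gauss_moment D_def simp flip: ennreal_mult)
  finally have D: "(\<integral>\<^sup>+t. ennreal (cmod (char \<nu> t - char ?\<gamma> t)) * indicator {-4*T..4*T} t \<partial>lborel) \<le> ennreal D" .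
  then have D': "(\<integral>\<^sup>+t. ennreal (cmod (char ?\<gamma> t - char \<nu> t)) * indicator {-4*T..4*T} t \<partial>lborel) \<le> ennreal D"
    by (simp add: norm_minus_commute)
  \<comment> \<open>A common bound for both smoothed densities: the Gaussian one is at most
    \<open>kern_mass\<close>, and passing to \<nu> adds \<open>D / 2\<close>, at most
    \<open>gauss_moment\<close>.\<close>
  define B where "B = kern_mass + gauss_moment"
  have B0: "0 \<le> B" using kern_mass_pos gauss_moment_nonneg by (simp add: B_def)
  have D2: "D / 2 \<le> gauss_moment"
  proof -
    have "D / 2 = 16 * ((L * x ^ 3) * gauss_moment)" by (simp add: D_def)
    then show ?thesis
      using mult_right_mono[OF L(2) gauss_moment_nonneg] gauss_moment_nonneg by linarith
  qed
  have B\<nu>: "smoothed \<nu> T v \<le> ennreal B" for v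
  proof -
    have "smoothed \<nu> T v \<le> smoothed ?\<gamma> T v + ennreal (D / 2)"
      by (rule smoothed_le_add[OF fin G.finite_measure_axioms s _ T D0 D]) simp
    also have "\<dots> \<le> ennreal kern_mass + ennreal gauss_moment"
      using D2 by (intro add_mono smoothed_std_normal_le T ennreal_leI)
    also have "\<dots> = ennreal B"
      unfolding B_def using kern_mass_pos gauss_moment_nonneg by (intro ennreal_plus[symmetric]) auto
    finally show ?thesis .
  qed
  have B\<gamma>: "smoothed ?\<gamma> T v \<le> ennreal B" for v
    unfolding B_def by (rule order.trans[OF smoothed_std_normal_le[OF T] ennreal_leI]) (simp add: gauss_moment_nonneg)
  have mass: "measure \<nu> (space \<nu>) \<le> 2"
  proof -
    \<comment> \<open>The total mass is the characteristic function at 0.\<close>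
    obtain \<eta> :: complex where \<eta>: "cmod \<eta> \<le> 4 * L * x ^ 3" "char \<nu> 0 = exp \<eta>"
      using char[of 0] L by auto
    have "measure \<nu> (space \<nu>) = cmod (char \<nu> 0)" by (simp add: char_def)
    also have "\<dots> \<le> exp (cmod \<eta>)" unfolding \<eta>(2) by (rule norm_exp)
    also have "\<dots> \<le> exp (1/32)" using \<eta>(1) L(2) by simp
    also have "\<dots> \<le> 2"
      using exp_bound[of "1/32"] by (simp add: power2_eq_square)
    finally show ?thesis .
  qed
  have mass\<gamma>: "measure ?\<gamma> (space ?\<gamma>) \<le> 2" using G.prob_space by simp
  have x0: "0 < x" using x by simp
  define a where "a = (LINT u|\<nu>. lap x u)"
  define b where "b = (LINT u|?\<gamma>. lap x u)"
  define E where "E = 16 * gauss_moment + 512 * (2 * kern_moment + 16 * B * (kern_moment + kern_mass))"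
  have err: "D / (2 * x) + 2 * (x * kern_moment * 2 + 16 * B * (kern_moment + kern_mass)) / T \<le> E * (L * x\<^sup>2)"
  proof -
    have "D / (2 * x) = 16 * gauss_moment * (L * x\<^sup>2)"
      using x by (simp add: D_def power_numeral_reduce)
    \<comment> \<open>Since x is at least 1, both terms of the smoothing error can be raised to
      order x^2.\<close>
    moreover have "2 * (x * kern_moment * 2 + 16 * B * (kern_moment + kern_mass)) / T
      \<le> 2 * (x\<^sup>2 * kern_moment * 2 + x\<^sup>2 * (16 * B * (kern_moment + kern_mass))) / T"
    proof -
      have "1 \<le> x\<^sup>2" "x \<le> x\<^sup>2" using x by (auto intro: self_le_power one_le_power)
      moreover have "0 \<le> 16 * B * (kern_moment + kern_mass)"
        using B0 kern_moment_nonneg kern_mass_pos by simp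
      ultimately show ?thesis
        using T kern_moment_nonneg mult_right_mono[of 1 "x\<^sup>2" "16 * B * (kern_moment + kern_mass)"]
        by (intro divide_right_mono mult_left_mono add_mono mult_right_mono) auto
    qed
    moreover have "2 * (x\<^sup>2 * kern_moment * 2 + x\<^sup>2 * (16 * B * (kern_moment + kern_mass))) / T
      = 512 * (2 * kern_moment + 16 * B * (kern_moment + kern_mass)) * (L * x\<^sup>2)"
      unfolding T_def by (simp add: algebra_simps)
    ultimately show ?thesis unfolding E_def by (simp add: ring_distribs)
  qed
  have s2: "sets ?\<gamma> = sets borel" by simp
  have "kern_mass * a \<le> kern_mass * b + E * (L * x\<^sup>2)"
    using smoothing_inequality[OF fin G.finite_measure_axioms s s2 T x0 D0 D B0 B\<nu> B\<gamma> mass mass\<gamma>] err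
    unfolding a_def b_def by linarith
  moreover have "kern_mass * b \<le> kern_mass * a + E * (L * x\<^sup>2)"
    using smoothing_inequality[OF G.finite_measure_axioms fin s2 s T x0 D0 D' B0 B\<gamma> B\<nu> mass\<gamma> mass] err
    unfolding a_def b_def by linarith
  ultimately have "kern_mass * \<bar>a - b\<bar> \<le> E * (L * x\<^sup>2)"
    by (cases "a \<le> b") (auto simp: right_diff_distrib)
  then have ab: "\<bar>a - b\<bar> \<le> E * (L * x\<^sup>2) / kern_mass"
    using kern_mass_pos by (simp add: pos_le_divide_eq mult.commute)
  define c where "c = exp (- 1) * std_normal_density 1"
  have c: "0 < c" by (simp add: c_def normal_density_pos)
  have b: "c / x \<le> b" using lap_std_normal_ge[OF x] by (simp add: b_def c_def)
  have b0: "0 < b" using c x0 b by (meson divide_pos_pos less_le_trans)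
  have E0: "0 \<le> E"
    using gauss_moment_nonneg kern_moment_nonneg B0 kern_mass_pos by (simp add: E_def)
  have "a / b - 1 = (a - b) / b"
    using b0 by (simp add: diff_divide_distrib)
  then have "\<bar>a / b - 1\<bar> = \<bar>a - b\<bar> / b"
    using b0 by (simp add: abs_divide)
  \<comment> \<open>Dividing by a quantity of order 1/x costs the last factor x.\<close>
  also have "\<dots> \<le> (E * (L * x\<^sup>2) / kern_mass) / (c / x)"
    using ab b c x0 E0 L kern_mass_pos by (intro frac_le) auto
  also have "\<dots> = E / (kern_mass * c) * (L * x ^ 3)"
    using x0 c kern_mass_pos by (simp add: power_numeral_reduce)
  also have "E / (kern_mass * c) = cramer_const"
    by (simp add: cramer_const_def E_def B_def c_def)
  finally show ?thesis by (simp add: a_def b_def)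
qed

text \<open>It must be checked that \<kappa> times the modulus of z = x + i t stays below 1/4 on the
  whole range of t. The smallness hypothesis handles x; unit variance handles t, since it forces L =
  n \<kappa>^3 to be at least \<kappa>/2, where n is the number of summands.\<close>

lemma (in prob_space) cramer_moderate_deviation:
  fixes X :: "'i \<Rightarrow> 'a \<Rightarrow> real" and \<kappa> x :: real
  assumes ind: "indep_vars (\<lambda>_. borel) X I" and fin: "finite I"
    and X: "\<And>i. i \<in> I \<Longrightarrow> integrable M (X i)" "\<And>i. i \<in> I \<Longrightarrow> expectation (X i) = 0"
      "\<And>i. i \<in> I \<Longrightarrow> integrable M (\<lambda>\<omega>. (X i \<omega>)\<^sup>2)"
    and mom: "\<And>i j. i \<in> I \<Longrightarrow> 2 \<le> j \<Longrightarrow> (\<integral>\<^sup>+\<omega>. ennreal (\<bar>X i \<omega>\<bar> ^ j) \<partial>M) \<le> ennreal (fact j * \<kappa> ^ j)"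
    and \<kappa>: "0 \<le> \<kappa>" and var: "(\<Sum>i\<in>I. expectation (\<lambda>\<omega>. (X i \<omega>)\<^sup>2)) = 1"
    and x: "1 \<le> x" and small: "card I * \<kappa> ^ 3 * x ^ 3 \<le> 1 / 512"
  shows "\<bar>prob {\<omega> \<in> space M. x < (\<Sum>i\<in>I. X i \<omega>)} / (1 - Phi x) - 1\<bar> \<le> cramer_const * (card I * \<kappa> ^ 3 * x ^ 3)"
proof -
  define W where "W \<omega> = (\<Sum>i\<in>I. X i \<omega>)" for \<omega>
  have [measurable]: "random_variable borel (X i)" if "i \<in> I" for i
    using ind that by (auto simp: indep_vars_def)
  have W[measurable]: "random_variable borel W" unfolding W_def[abs_def] by measurable
  define n where "n = real (card I)"
  define L where "L = n * \<kappa> ^ 3"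
  \<comment> \<open>The variances sum to 1 and each is at most twice \<kappa>^2.\<close>
  have "1 \<le> (\<Sum>i\<in>I. 2 * \<kappa>\<^sup>2)"
    unfolding var[symmetric] by (intro sum_mono second_moment_le X mom) auto
  then have n\<kappa>: "1 \<le> 2 * (n * \<kappa>\<^sup>2)" by (simp add: n_def)
  have n1: "1 \<le> n"
  proof -
    have "card I \<noteq> 0" using n\<kappa> by (intro notI) (simp add: n_def)
    then show ?thesis by (simp add: n_def Suc_le_eq)
  qed
  have \<kappa>0: "0 < \<kappa>" using n\<kappa> \<kappa> by (cases "\<kappa> = 0") auto
  have L0: "0 < L" using n1 \<kappa>0 by (simp add: L_def)
  have "(\<kappa> * x) ^ 3 \<le> (1/8) ^ 3"
  proof -
    have "1 * (\<kappa> * x) ^ 3 \<le> n * (\<kappa> * x) ^ 3" using n1 \<kappa> x by (intro mult_right_mono) auto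
    also have "\<dots> \<le> 1 / 512" using small by (simp add: n_def power_mult_distrib mult_ac)
    finally show ?thesis by (simp add: power_numeral_reduce)
  qed
  then have \<kappa>x: "\<kappa> * x \<le> 1/8" using \<kappa> x by (subst (asm) power_mono_iff) auto
  have \<kappa>t: "\<kappa> * \<bar>t\<bar> \<le> 1/32" if "\<bar>t\<bar> \<le> 1 / (64 * L)" for t
  proof -
    have "\<kappa> * \<bar>t\<bar> \<le> \<kappa> * (1 / (64 * L))" using that \<kappa> by (intro mult_left_mono)
    also have "\<dots> = 1 / (64 * (n * \<kappa>\<^sup>2))" using \<kappa>0 n1 by (simp add: L_def power_numeral_reduce)
    also have "\<dots> \<le> 1 / 32" using n\<kappa> by (intro divide_left_mono) auto
    finally show ?thesis .
  qed
  have cz: "cmod (Complex x t) \<le> x + \<bar>t\<bar>" for t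
    using x cmod_le[of "Complex x t"] by simp
  have small_z: "\<kappa> * cmod (Complex x t) \<le> 1/4" if "\<bar>t\<bar> \<le> 1 / (64 * L)" for t
    using mult_left_mono[OF cz[of t] \<kappa>] \<kappa>x \<kappa>t[OF that] by (simp add: ring_distribs)
  \<comment> \<open>Taking norms at t = 0 gives integrability of the real exponential.\<close>
  have "complex_integrable M (\<lambda>\<omega>. exp (Complex x 0 * W \<omega>))"
    unfolding W_def using L0 by (intro integrable_exp_indep_sum[OF ind fin X mom \<kappa> small_z]) auto
  then have "integrable M (\<lambda>\<omega>. cmod (exp (Complex x 0 * W \<omega>)))" by (rule integrable_norm)
  then have int: "integrable M (\<lambda>\<omega>. exp (x * W \<omega>))" by simp
  have fin\<nu>: "finite_measure (tilted M W x)" by (rule finite_measure_tilted[OF W int])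
  have char: "\<exists>\<eta>. cmod \<eta> \<le> 4 * L * (x + \<bar>t\<bar>) ^ 3 \<and> char (tilted M W x) t = exp (complex_of_real (- (t\<^sup>2 / 2)) + \<eta>)"
    if t: "\<bar>t\<bar> \<le> 1 / (64 * L)" for t
  proof -
    obtain \<eta> :: complex where \<eta>: "cmod \<eta> \<le> 4 * L * cmod (Complex x t) ^ 3"
      "(CLINT \<omega>|M. exp (Complex x t * W \<omega>)) = exp ((Complex x t)\<^sup>2 / 2 * 1 + \<eta>)"
      using mgf_indep_sum[OF ind fin X mom \<kappa> small_z[OF t]] unfolding W_def L_def n_def var of_real_1 by blast
    have "4 * L * cmod (Complex x t) ^ 3 \<le> 4 * L * (x + \<bar>t\<bar>) ^ 3"
      using L0 by (intro mult_left_mono power_mono cz) auto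
    moreover have "char (tilted M W x) t = exp (complex_of_real (- (t\<^sup>2 / 2)) + \<eta>)"
      unfolding char_tilted[OF W] \<eta>(2) exp_add[symmetric]
      \<comment> \<open>The exponents combine as (x + i t)^2/2 - x^2/2 - i t x = -t^2/2.\<close>
      by (rule arg_cong[where f=exp]) (simp add: Complex_eq power2_eq_square algebra_simps add_divide_distrib diff_divide_distrib)
    ultimately show ?thesis using \<eta>(1) by (intro exI[of _ \<eta>]) auto
  qed
  have "prob {\<omega> \<in> space M. x < W \<omega>} / (1 - Phi x)
    = (LINT u|tilted M W x. lap x u) / (LINT u|std_normal_distribution. lap x u)"
    unfolding lap_tilted[OF finite_measure_axioms W] Phi_def std_normal_tail_eq by simp
  moreover have "\<bar>(LINT u|tilted M W x. lap x u) / (LINT u|std_normal_distribution. lap x u) - 1\<bar> \<le> cramer_const * (L * x ^ 3)"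
    using small by (intro tail_ratio_bound[OF fin\<nu> _ x L0 _ char]) (auto simp: L_def n_def)
  ultimately show ?thesis by (simp add: L_def n_def W_def)
qed

section \<open>From the bound at fixed \<open>m\<close> to the asymptotic statement\<close>

theorem theorem3p1:
  fixes M :: "nat \<Rightarrow> 'a measure"
    and X :: "nat \<Rightarrow> nat \<Rightarrow> 'a \<Rightarrow> real"
    and \<delta> C :: real
    and x :: "nat \<Rightarrow> real"
  assumes prob: "\<And>m. m \<ge> 1 \<Longrightarrow> prob_space (M m)"
    and rv: "\<And>m i. m \<ge> 1 \<Longrightarrow> i \<in> {1..m} \<Longrightarrow> X m i \<in> borel_measurable (M m)"
    and indep: "\<And>m. m \<ge> 1 \<Longrightarrow> prob_space.indep_vars (M m) (\<lambda>_. borel) (X m) {1..m}"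
    and integ: "\<And>m i. m \<ge> 1 \<Longrightarrow> i \<in> {1..m} \<Longrightarrow> integrable (M m) (X m i)"
    and mean0: "\<And>m i. m \<ge> 1 \<Longrightarrow> i \<in> {1..m} \<Longrightarrow> prob_space.expectation (M m) (X m i) = 0"
    and finvar: "\<And>m i. m \<ge> 1 \<Longrightarrow> i \<in> {1..m} \<Longrightarrow> integrable (M m) (\<lambda>\<omega>. (X m i \<omega>)\<^sup>2)"
    and sigma_ge: "\<And>m. m \<ge> 1 \<Longrightarrow> sigma_seq M X m \<ge> 1"
    and delta: "0 \<le> \<delta>" "\<delta> < 1"
    and Cge: "C \<ge> 1"
    and moments: "\<And>m i j. m \<ge> 1 \<Longrightarrow> i \<in> {1..m} \<Longrightarrow> j \<ge> 2 \<Longrightarrow>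
        (\<integral>\<^sup>+ \<omega>. ennreal (\<bar>X m i \<omega>\<bar> ^ j) \<partial>M m)
          \<le> ennreal (fact j * (C * sigma_seq M X m) powr ((1 + \<delta>) * real j))"
    and sigma_lim: "(\<lambda>m. sigma_seq M X m powr \<delta> / real m powr (1/6)) \<longlonglongrightarrow> 0"
    and x_inf: "filterlim x at_top sequentially"
    and x_lim: "(\<lambda>m. x m * sigma_seq M X m powr \<delta> / real m powr (1/6)) \<longlonglongrightarrow> 0"
  shows "(\<lambda>m. (1 - F_seq M X m (x m)) / (1 - Phi (x m)) - 1)
           \<in> O(\<lambda>m. sigma_seq M X m powr (3 * \<delta>) * (x m) ^ 3 / sqrt (real m))"
proof -
  define K where "K = C powr (3 * (1 + \<delta>))"
  define r where "r m = sigma_seq M X m powr (3 * \<delta>) * (x m) ^ 3 / sqrt (real m)" for m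
  have bound: "\<bar>(1 - F_seq M X m (x m)) / (1 - Phi (x m)) - 1\<bar> \<le> cramer_const * (K * r m)"
    if m: "m \<ge> 1" and x1: "1 \<le> x m" and small: "K * r m \<le> 1 / 512" for m
  proof -
    interpret prob_space "M m" by (rule prob[OF m])
    define \<sigma> where "\<sigma> = sigma_seq M X m"
    define s where "s = \<sigma> * sqrt (real m)"
    \<comment> \<open>Dividing a summand by \<open>s\<close> divides its j-th moment by s^j, so the
      given moment bound becomes \<open>fact j * \<kappa> ^ j\<close>.\<close>
    define \<kappa> where "\<kappa> = (C * \<sigma>) powr (1 + \<delta>) / s"
    have \<sigma>: "1 \<le> \<sigma>" using sigma_ge[OF m] by (simp add: \<sigma>_def)
    have s: "0 < s" using \<sigma> m by (simp add: s_def)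
    have \<kappa>: "0 \<le> \<kappa>" using s by (simp add: \<kappa>_def)
    have ind: "indep_vars (\<lambda>_. borel) (\<lambda>i \<omega>. X m i \<omega> / s) {1..m}"
      by (rule indep_vars_compose2[OF indep[OF m]]) measurable
    have "(\<integral>\<^sup>+\<omega>. ennreal (\<bar>X m i \<omega> / s\<bar> ^ j) \<partial>M m) \<le> ennreal (fact j * \<kappa> ^ j)"
      if i: "i \<in> {1..m}" and j: "2 \<le> j" for i j
    proof -
      note [measurable] = rv[OF m i]
      have "(\<integral>\<^sup>+\<omega>. ennreal (\<bar>X m i \<omega> / s\<bar> ^ j) \<partial>M m)
        = ennreal (1 / s ^ j) * (\<integral>\<^sup>+\<omega>. ennreal (\<bar>X m i \<omega>\<bar> ^ j) \<partial>M m)"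
        using s by (subst nn_integral_cmult[symmetric])
          (auto intro!: nn_integral_cong simp: abs_divide power_divide simp flip: ennreal_mult)
      also have "\<dots> \<le> ennreal (1 / s ^ j) * ennreal (fact j * (C * \<sigma>) powr ((1 + \<delta>) * real j))"
        using moments[OF m i j] by (intro mult_left_mono) (auto simp: \<sigma>_def)
      also have "\<dots> = ennreal (fact j * \<kappa> ^ j)"
        using s Cge \<sigma> by (simp add: \<kappa>_def power_divide powr_power mult_ac flip: ennreal_mult)
      finally show ?thesis .
    qed
    note mom = this
    have var: "(\<Sum>i\<in>{1..m}. expectation (\<lambda>\<omega>. (X m i \<omega> / s)\<^sup>2)) = 1"
    proof -
      have "(\<Sum>i=1..m. variance (X m i)) = real m * \<sigma>\<^sup>2"
      proof -
        have "0 \<le> (\<Sum>i=1..m. variance (X m i))" by (intro sum_nonneg variance_positive)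
        then show ?thesis using m by (simp add: \<sigma>_def sigma_seq_def)
      qed
      then have "(\<Sum>i=1..m. expectation (\<lambda>\<omega>. (X m i \<omega>)\<^sup>2)) = s\<^sup>2"
        by (simp add: mean0[OF m] s_def power_mult_distrib mult.commute)
      moreover have "(\<Sum>i\<in>{1..m}. expectation (\<lambda>\<omega>. (X m i \<omega> / s)\<^sup>2)) = (\<Sum>i=1..m. expectation (\<lambda>\<omega>. (X m i \<omega>)\<^sup>2)) / s\<^sup>2"
        by (simp add: power_divide sum_divide_distrib)
      ultimately show ?thesis using s by simp
    qed
    \<comment> \<open>In m \<kappa>^3, the power 3 (1 + \<delta>) of \<sigma> loses 3 to s^3, and m
      / m^(3/2) leaves 1 / sqrt m.\<close>
    have K: "real (card {1..m}) * \<kappa> ^ 3 * x m ^ 3 = K * r m"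
    proof -
      have "\<kappa> ^ 3 = (C * \<sigma>) powr (3 * (1 + \<delta>)) / s ^ 3"
        using Cge \<sigma> by (simp add: \<kappa>_def power_divide powr_power)
      also have "(C * \<sigma>) powr (3 * (1 + \<delta>)) = K * (\<sigma> powr 3 * \<sigma> powr (3 * \<delta>))"
        using Cge \<sigma> unfolding K_def powr_add[symmetric] by (simp add: powr_mult ring_distribs)
      also have "\<sigma> powr 3 = \<sigma> ^ 3" using \<sigma> by simp
      also have "s ^ 3 = \<sigma> ^ 3 * (sqrt (real m) * real m)"
        by (simp add: s_def power_mult_distrib power3_eq_cube)
      finally show ?thesis using \<sigma> m by (simp add: r_def \<sigma>_def)
    qed
    have "1 - F_seq M X m (x m) = prob {\<omega> \<in> space (M m). x m < (\<Sum>i\<in>{1..m}. X m i \<omega> / s)}"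
    proof -
      define W where "W \<omega> = (\<Sum>i\<in>{1..m}. X m i \<omega> / s)" for \<omega>
      have [measurable]: "random_variable borel W"
        unfolding W_def by (intro borel_measurable_sum borel_measurable_divide rv[OF m] borel_measurable_const)
      have "F_seq M X m (x m) = prob {\<omega> \<in> space (M m). W \<omega> \<le> x m}"
        unfolding F_seq_def cdf_def s_def[symmetric] \<sigma>_def[symmetric] sum_divide_distrib W_def[symmetric]
        by (subst measure_distr) (auto intro!: arg_cong[where f=prob])
      then show ?thesis
        unfolding W_def[symmetric] using prob_neg[of "\<lambda>\<omega>. W \<omega> \<le> x m"] by (simp add: not_le)
    qed
    moreover have "\<bar>prob {\<omega> \<in> space (M m). x m < (\<Sum>i\<in>{1..m}. X m i \<omega> / s)} / (1 - Phi (x m)) - 1\<bar>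
      \<le> cramer_const * (real (card {1..m}) * \<kappa> ^ 3 * x m ^ 3)"
      by (rule cramer_moderate_deviation[OF ind _ _ _ _ mom \<kappa> var x1])
        (use integ[OF m] mean0[OF m] finvar[OF m] K small in \<open>auto simp: power_divide\<close>)
    ultimately show ?thesis unfolding K by simp
  qed
  \<comment> \<open>The relative error is the cube of the sequence in \<open>x_lim\<close>; hence it
    tends to 0, and the smallness required by \<open>bound\<close> holds eventually.\<close>
  have "r m = (x m * sigma_seq M X m powr \<delta> / real m powr (1/6)) ^ 3" if "m \<ge> 1" for m
    using that sigma_ge[OF that]
    by (simp add: r_def power_mult_distrib power_divide powr_power powr_half_sqrt mult.commute)
  then have "eventually (\<lambda>m. (x m * sigma_seq M X m powr \<delta> / real m powr (1/6)) ^ 3 = r m) sequentially"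
    by (intro eventually_sequentiallyI[of 1]) simp
  moreover have "(\<lambda>m. (x m * sigma_seq M X m powr \<delta> / real m powr (1/6)) ^ 3) \<longlonglongrightarrow> 0"
    using tendsto_power[OF x_lim, of 3] by simp
  ultimately have "r \<longlonglongrightarrow> 0"
    by (rule Lim_transform_eventually[rotated])
  then have "(\<lambda>m. K * r m) \<longlonglongrightarrow> 0" by (rule tendsto_mult_right_zero)
  then have "eventually (\<lambda>m. K * r m < 1 / 512) sequentially"
    by (rule order_tendstoD) simp
  moreover have "eventually (\<lambda>m. 1 \<le> x m) sequentially"
    using x_inf by (simp add: filterlim_at_top)
  moreover note eventually_ge_at_top[of 1]
  ultimately have "eventually (\<lambda>m. norm ((1 - F_seq M X m (x m)) / (1 - Phi (x m)) - 1) \<le> cramer_const * K * norm (r m)) sequentially"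
  proof eventually_elim
    case (elim m)
    have "0 \<le> r m" using elim by (simp add: r_def)
    then show ?case using bound[of m] elim by (simp add: mult.assoc)
  qed
  then show ?thesis unfolding r_def by (rule bigoI)
qed

end
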